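(* For every integer $k\ge 3$, \[ \mathcal C_{k}(n)= O\left( n^{2k/5+ 1+\gamma(k)}\right), \] where \[ \gamma(k) = \begin{cases} \frac{1}{75}\cdot\left( 4 - 4\cdot (-1/4)^{k/4} \right) & \text{ if } k \equiv 0 \pmod{4}, \\ \frac{1}{75}\cdot\left( 4 - 9\cdot (-1/4)^{\lfloor k/4\rfloor} \right) & \text{ if } k \equiv 1 \pmod{4}, \\ \frac{1}{75}\cdot\left( 4 + 11\cdot (-1/4)^{\lfloor k/4\rfloor} \right) & \text{ if } k \equiv 2 \pmod{4}, \\ \frac{1}{75}\cdot\left( 4 - \frac{13}{2} \cdot (-1/4)^{\lfloor k/4\rfloor} \right) & \text{ if } k \equiv 3 \pmod{4}. \end{cases} \] (Here $k$ is a fixed constant and the implied constant may depend on $k$.)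
   Context: For points $p,q\in\mathbb{R}^2$, $|pq|$ denotes the Euclidean distance. Given a finite set $\mathcal P\subset\mathbb{R}^2$, a positive integer $k$, and a sequence of positive distances $(\delta_1,\ldots,\delta_k)$, a $k$-chain is a $(k+1)$-tuple of distinct points $(p_1,\ldots,p_{k+1})\in\mathcal P^{k+1}$ with $|p_jp_{j+1}|=\delta_j$ for every $1\le j\le k$. $\mathcal C_k(n)$ denotes the maximum, over all sets $\mathcal P$ of $n$ points in $\mathbb{R}^2$ and all sequences of distances $(\delta_1,\ldots,\delta_k)$, of the number of $k$-chains. *)

theory Defs
  imports "HOL-Analysis.Analysis" "HOL-Library.Landau_Symbols"
begin

(* Tuples and distance sequences are lists, so the 1-based p_j and delta_j are
   ps ! (j - 1) and ds ! (j - 1). *)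
definition k_chains :: "nat \<Rightarrow> (real^2) set \<Rightarrow> real list \<Rightarrow> (real^2) list set" where
  "k_chains k P ds =
     {ps. length ps = k + 1 \<and> set ps \<subseteq> P \<and> distinct ps \<and>
          (\<forall>j<k. dist (ps ! j) (ps ! (j + 1)) = ds ! j)}"

definition chain_counts :: "nat \<Rightarrow> nat \<Rightarrow> nat set" where
  "chain_counts k n =
     {card (k_chains k P ds) | P ds.
        finite P \<and> card P = n \<and> length ds = k \<and> (\<forall>\<delta>\<in>set ds. \<delta> > 0)}"

definition max_chains :: "nat \<Rightarrow> nat \<Rightarrow> nat" where
  "max_chains k n = Max (chain_counts k n)"

definition chain_gamma :: "nat \<Rightarrow> real" where
  "chain_gamma k =
     (if k mod 4 = 0 then 1/75 * (4 - 4 * (-1/4) ^ (k div 4))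
      else if k mod 4 = 1 then 1/75 * (4 - 9 * (-1/4) ^ (k div 4))
      else if k mod 4 = 2 then 1/75 * (4 + 11 * (-1/4) ^ (k div 4))
      else 1/75 * (4 - 13/2 * (-1/4) ^ (k div 4)))"

lemma k_chains_subset: "k_chains k P ds \<subseteq> {ps. set ps \<subseteq> P \<and> length ps = k + 1}"
  by (auto simp: k_chains_def)

lemma finite_k_chains: "finite P \<Longrightarrow> finite (k_chains k P ds)"
  by (rule finite_subset[OF k_chains_subset]) (rule finite_lists_length_eq)

lemma card_k_chains_le:
  assumes "finite P"
  shows "card (k_chains k P ds) \<le> card P ^ (k + 1)"
  using card_mono[OF finite_lists_length_eq[OF assms] k_chains_subset, of k ds]
  by (simp only: card_lists_length_eq[OF assms])

(* The next two facts show that the Max in max_chains ranges over a finite nonempty set. *)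
lemma finite_chain_counts: "finite (chain_counts k n)"
proof (rule finite_subset)
  show "chain_counts k n \<subseteq> {..n ^ (k + 1)}"
    unfolding chain_counts_def using card_k_chains_le by blast
qed simp

lemma chain_counts_nonempty: "chain_counts k n \<noteq> {}"
proof -
  have "infinite (UNIV :: (real^2) set)"
    by (rule infinite_UNIV_vec) (rule infinite_UNIV_char_0)
  then obtain P :: "(real^2) set" where "finite P" "card P = n"
    using infinite_arbitrarily_large by blast
  then have "card (k_chains k P (replicate k 1)) \<in> chain_counts k n"
    unfolding chain_counts_def by (auto intro!: exI[of _ P] exI[of _ "replicate k 1"])
  then show ?thesis by blast
qed

end

theory Submission
  imports Defs
begin

text \<open>
  Let \<open>E k\<close> be the claimed exponent. It satisfies \<open>E (k + 3) = (E k + E (k + 1)) / 2 + 1\<close> with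
  \<open>E 0 = 1\<close>, \<open>E 1 = 4/3\<close>, \<open>E 2 = 2\<close>, so it suffices to show that, up to a constant,
  \<open>C (k + 3) \<le> t\<^sup>2 C (k + 1) + (n\<^sup>2 / t\<^sup>2 + n) C k\<close> for every threshold \<open>t > 0\<close>. If the second
  and the penultimate point of a chain both have at most \<open>t\<close> neighbours at the respective distance,
  deleting the two end points gives the first term. Otherwise one of them, say the second, is heavy;
  by the Szemeredi-Trotter bound there are \<open>O(n\<^sup>2 / t\<^sup>2 + n)\<close> choices for the first two points, and
  the third one is determined up to two choices by its neighbours, which gives the second term.

  The incidence bound follows Szekely: upper (or lower) semicircles of a fixed radius are
  \<open>x\<close>-monotone and meet pairwise at most once, so the arcs between consecutive points form a simple
  graph drawn with few crossings. That a crossing-free \<open>x\<close>-monotone drawing has at most \<open>3 |V|\<close> edges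
  is shown by a sweep: the wedge between two vertically consecutive edges leaving a vertex to the
  right is charged to the first vertex met inside it, and every vertex is charged at most twice.
\<close>

section \<open>Crossing-free drawings by \<open>x\<close>-monotone curves\<close>

lemma vec2_eqI: "a $ 1 = b $ 1 \<Longrightarrow> a $ 2 = b $ 2 \<Longrightarrow> a = (b :: real^2)"
  by (simp add: vec_eq_iff forall_2)

text \<open>The edge \<open>e\<close> is the graph of \<open>g e\<close> between the abscissae of
  \<open>L e\<close> and \<open>R e\<close>. The conditions \<open>vertex_free\<close> and
  \<open>noncrossing\<close> concern interior abscissae only, so edges may share end
  vertices.\<close>

locale noncrossing_drawing =
  fixes V :: "(real^2) set" and F :: "'e set" and L R :: "'e \<Rightarrow> real^2" and g :: "'e \<Rightarrow> real \<Rightarrow> real"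
  assumes finite_V: "finite V" and finite_F: "finite F"
    and L_in: "e \<in> F \<Longrightarrow> L e \<in> V" and R_in: "e \<in> F \<Longrightarrow> R e \<in> V"
    and L_less_R: "e \<in> F \<Longrightarrow> L e $ 1 < R e $ 1"
    and cont: "e \<in> F \<Longrightarrow> continuous_on {L e $ 1..R e $ 1} (g e)"
    and g_L: "e \<in> F \<Longrightarrow> g e (L e $ 1) = L e $ 2" and g_R: "e \<in> F \<Longrightarrow> g e (R e $ 1) = R e $ 2"
    and vertex_free: "e \<in> F \<Longrightarrow> v \<in> V \<Longrightarrow> L e $ 1 < v $ 1 \<Longrightarrow> v $ 1 < R e $ 1 \<Longrightarrow> g e (v $ 1) \<noteq> v $ 2"
    and noncrossing: "e \<in> F \<Longrightarrow> d \<in> F \<Longrightarrow> e \<noteq> d \<Longrightarrow> L e $ 1 < x \<Longrightarrow> x < R e $ 1 \<Longrightarrow>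
      L d $ 1 < x \<Longrightarrow> x < R d $ 1 \<Longrightarrow> g e x \<noteq> g d x"
    and simple: "e \<in> F \<Longrightarrow> d \<in> F \<Longrightarrow> L e = L d \<Longrightarrow> R e = R d \<Longrightarrow> e = d"
begin

text \<open>By the intermediate value theorem, a reversal of the vertical order would force a
  crossing. Only the weak inequality carries over, because two edges may meet in a common
  end.\<close>

lemma order_preserved:
  assumes ed: "e \<in> F" "d \<in> F"
    and x: "L e $ 1 \<le> x" "x \<le> R e $ 1" "L d $ 1 \<le> x" "x \<le> R d $ 1"
    and y: "L e $ 1 \<le> y" "y \<le> R e $ 1" "L d $ 1 \<le> y" "y \<le> R d $ 1"
    and less: "g e x < g d x"
  shows "g e y \<le> g d y"
proof (rule ccontr)
  assume *: "\<not> g e y \<le> g d y"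
  define h where "h = (\<lambda>z. g d z - g e z)"
  have ne: "e \<noteq> d" using less by auto
  have xy: "x \<noteq> y" using less * by auto
  have "continuous_on {min x y..max x y} (g d)" "continuous_on {min x y..max x y} (g e)"
    using x y by (auto intro!: continuous_on_subset[OF cont] ed)
  then have c: "continuous_on {min x y..max x y} h"
    unfolding h_def by (intro continuous_intros)
  have hx: "h x > 0" and hy: "h y < 0" using less * by (auto simp: h_def)
  have "\<exists>z. min x y \<le> z \<and> z \<le> max x y \<and> h z = 0"
  proof (cases "x < y")
    case True
    then show ?thesis using IVT2'[of h y 0 x] hx hy c by (auto simp: min_def max_def)
  next
    case False
    then show ?thesis using IVT'[of h y 0 x] hx hy c xy by (auto simp: min_def max_def)
  qed
  then obtain z where z: "min x y \<le> z" "z \<le> max x y" "h z = 0" by blast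
  \<comment> \<open>The signs of \<open>h\<close> put the zero strictly between \<open>x\<close> and
    \<open>y\<close>, hence in the interior of both edges.\<close>
  have "z \<noteq> x" "z \<noteq> y" using z hx hy by auto
  then have "min x y < z" "z < max x y" using z by (auto simp: min_def max_def split: if_splits)
  then have "g e z \<noteq> g d z" using x y
    by (intro noncrossing[OF ed ne]) (auto simp: min_def max_def split: if_splits)
  then show False using z by (simp add: h_def)
qed

lemma order_preserved_strict:
  assumes ed: "e \<in> F" "d \<in> F"
    and x: "L e $ 1 \<le> x" "x \<le> R e $ 1" "L d $ 1 \<le> x" "x \<le> R d $ 1"
    and y: "L e $ 1 < y" "y < R e $ 1" "L d $ 1 < y" "y < R d $ 1"
    and less: "g e x < g d x"
  shows "g e y < g d y"
proof -
  have "g e y \<le> g d y" using order_preserved[OF ed x _ _ _ _ less, of y] y by simp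
  moreover have "g e y \<noteq> g d y" using noncrossing[OF ed _ y] less by auto
  ultimately show ?thesis by simp
qed

section \<open>Upper neighbours among the edges leaving a vertex\<close>

definition next_above :: "'e \<Rightarrow> 'e \<Rightarrow> bool" where
  "next_above e e' \<longleftrightarrow> e' \<in> F \<and> L e' = L e \<and>
     (\<forall>x. L e $ 1 < x \<longrightarrow> x < R e $ 1 \<longrightarrow> x < R e' $ 1 \<longrightarrow> g e x < g e' x) \<and>
     (\<forall>d\<in>F. \<forall>x. L d = L e \<longrightarrow> L e $ 1 < x \<longrightarrow> x < R e $ 1 \<longrightarrow> x < R e' $ 1 \<longrightarrow> x < R d $ 1 \<longrightarrow>
        \<not> (g e x < g d x \<and> g d x < g e' x))"

definition top_edges :: "'e set" where
  "top_edges = {e\<in>F. \<not> (\<exists>e'. next_above e e')}"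

text \<open>All edges leaving \<open>v\<close> agree at \<open>v\<close> itself, so their vertical
  order is read off at a slightly larger abscissa that all of them reach.\<close>

lemma ex_abscissa_before_right_ends:
  assumes "v \<in> V"
  obtains x0 where "v $ 1 < x0" "\<And>e. e \<in> F \<Longrightarrow> L e = v \<Longrightarrow> x0 < R e $ 1"
proof -
  \<comment> \<open>The extra element \<open>v $ 1 + 1\<close> keeps the minimum defined when no
    edge leaves \<open>v\<close>.\<close>
  define S where "S = insert (v $ 1 + 1) ((\<lambda>e. R e $ 1) ` {e\<in>F. L e = v})"
  have S: "finite S" "S \<noteq> {}" using finite_F by (auto simp: S_def)
  have gt: "v $ 1 < s" if "s \<in> S" for s using that L_less_R by (auto simp: S_def)
  then have "v $ 1 < Min S" using S by simp
  then obtain x0 where x0: "v $ 1 < x0" "x0 < Min S" using dense by blast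
  then have "x0 < R e $ 1" if "e \<in> F" "L e = v" for e
    using that S Min_le[of S "R e $ 1"] by (force simp: S_def)
  then show ?thesis using that x0 by blast
qed

text \<open>Of two edges leaving the same vertex, the one that is lower at \<open>x0\<close> has
  edges above it there, and the lowest of these is its upper neighbour.\<close>

lemma top_edges_inj: "inj_on L top_edges"
proof (rule inj_onI, rule ccontr)
  fix a b assume ab: "a \<in> top_edges" "b \<in> top_edges" "L a = L b" "a \<noteq> b"
  have F: "a \<in> F" "b \<in> F" using ab by (auto simp: top_edges_def)
  obtain x0 where x0: "L a $ 1 < x0" "\<And>e. e \<in> F \<Longrightarrow> L e = L a \<Longrightarrow> x0 < R e $ 1"
    using ex_abscissa_before_right_ends[OF L_in[OF F(1)]] by blast
  have not_below: False
    if cd: "c \<in> top_edges" "c \<in> F" "d \<in> F" "L c = L a" "L d = L a" "g c x0 < g d x0" for c d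
  proof -
    define S where "S = {e\<in>F. L e = L a \<and> g c x0 < g e x0}"
    have S: "finite S" "S \<noteq> {}" using finite_F cd by (auto simp: S_def)
    obtain e where e: "e \<in> S" "\<And>f. f \<in> S \<Longrightarrow> g e x0 \<le> g f x0"
      using ex_is_arg_min_if_finite[OF S, of "\<lambda>e. g e x0"] by (auto simp: is_arg_min_linorder)
    have eF: "e \<in> F" "L e = L a" "g c x0 < g e x0" using e by (auto simp: S_def)
    have "next_above c e" unfolding next_above_def
    proof (intro conjI ballI allI impI notI)
      show "e \<in> F" "L e = L c" using eF cd by auto
      show "g c x < g e x" if "L c $ 1 < x" "x < R c $ 1" "x < R e $ 1" for x
        using order_preserved_strict[OF cd(2) eF(1), of x0 x] that x0 eF cd by (auto simp: less_imp_le)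
      \<comment> \<open>An edge strictly between \<open>c\<close> and \<open>e\<close> at some
        \<open>x\<close> is strictly between them at \<open>x0\<close> too, against the minimality
        of \<open>e\<close>.\<close>
      fix d x assume d: "d \<in> F" "L d = L c" "L c $ 1 < x" "x < R c $ 1" "x < R e $ 1" "x < R d $ 1"
        "g c x < g d x \<and> g d x < g e x"
      have "g c x0 < g d x0"
        using order_preserved_strict[OF cd(2) d(1), of x x0] d x0 cd by (auto simp: less_imp_le)
      moreover have "g d x0 < g e x0"
        using order_preserved_strict[OF d(1) eF(1), of x x0] d x0 cd eF by (auto simp: less_imp_le)
      ultimately show False using e(2)[of d] d cd by (auto simp: S_def)
    qed
    then show False using cd by (auto simp: top_edges_def)
  qed
  have "g a x0 \<noteq> g b x0"
    using noncrossing[OF F ab(4), of x0] x0 F ab by auto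
  then consider "g a x0 < g b x0" | "g b x0 < g a x0" by linarith
  then show False
  proof cases
    case 1 then show False by (rule not_below[OF ab(1) F refl ab(3)[symmetric]])
  next
    case 2 then show False by (rule not_below[OF ab(2) F(2,1) ab(3)[symmetric] refl])
  qed
qed

section \<open>Wedges and the vertices that close them\<close>

definition closes_wedge :: "'e \<Rightarrow> 'e \<Rightarrow> real^2 \<Rightarrow> bool" where
  "closes_wedge e e' u \<longleftrightarrow> u \<in> V \<and> L e $ 1 < u $ 1 \<and> u $ 1 \<le> R e $ 1 \<and> u $ 1 \<le> R e' $ 1 \<and>
     g e (u $ 1) \<le> u $ 2 \<and> u $ 2 \<le> g e' (u $ 1) \<and>
     (\<forall>v\<in>V. L e $ 1 < v $ 1 \<longrightarrow> v $ 1 < u $ 1 \<longrightarrow> \<not> (g e (v $ 1) \<le> v $ 2 \<and> v $ 2 \<le> g e' (v $ 1)))"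

text \<open>The closed wedge contains the right end of whichever of the two edges stops first,
  because the weak order persists up to that abscissa; so there is a leftmost vertex in it.\<close>

lemma ex_closes_wedge:
  assumes e: "e \<in> F" and n: "next_above e e'"
  shows "\<exists>u. closes_wedge e e' u"
proof -
  have e': "e' \<in> F" "L e' = L e" using n by (auto simp: next_above_def)
  define W where "W = {v\<in>V. L e $ 1 < v $ 1 \<and> v $ 1 \<le> R e $ 1 \<and> v $ 1 \<le> R e' $ 1 \<and>
     g e (v $ 1) \<le> v $ 2 \<and> v $ 2 \<le> g e' (v $ 1)}"
  obtain x where x: "L e $ 1 < x" "x < min (R e $ 1) (R e' $ 1)"
    using dense[of "L e $ 1" "min (R e $ 1) (R e' $ 1)"] L_less_R[OF e] L_less_R[OF e'(1)] e' by auto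
  have gx: "g e x < g e' x" using n x by (auto simp: next_above_def)
  have le: "g e y \<le> g e' y" if "L e $ 1 \<le> y" "y \<le> R e $ 1" "y \<le> R e' $ 1" for y
    using order_preserved[OF e e'(1) _ _ _ _ _ _ _ _ gx] x e' that by auto
  have "R e \<in> W \<or> R e' \<in> W"
    using le[of "R e $ 1"] le[of "R e' $ 1"] g_R[OF e] g_R[OF e'(1)] L_less_R[OF e] L_less_R[OF e'(1)]
      R_in[OF e] R_in[OF e'(1)] e' by (cases "R e $ 1 \<le> R e' $ 1") (auto simp: W_def)
  then have "W \<noteq> {}" by auto
  moreover have "finite W" using finite_V by (auto simp: W_def)
  ultimately obtain u where u: "u \<in> W" "\<And>v. v \<in> W \<Longrightarrow> u $ 1 \<le> v $ 1"
    using ex_is_arg_min_if_finite[of W "\<lambda>v. v $ 1"] by (auto simp: is_arg_min_linorder)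
  have "closes_wedge e e' u" unfolding closes_wedge_def
  proof (intro conjI ballI impI notI)
    fix v assume v: "v \<in> V" "L e $ 1 < v $ 1" "v $ 1 < u $ 1" "g e (v $ 1) \<le> v $ 2 \<and> v $ 2 \<le> g e' (v $ 1)"
    then have "v \<in> W" using u(1) by (auto simp: W_def)
    then show False using u(2) v by force
  qed (use u(1) in \<open>auto simp: W_def\<close>)
  then show ?thesis by blast
qed

text \<open>Followed to the left, an edge inside the wedge either starts inside it, before the first
  vertex there, or runs across the apex, against \<open>vertex_free\<close>, or starts at the apex,
  against the choice of \<open>e'\<close> as upper neighbour of \<open>e\<close>.\<close>

lemma wedge_empty:
  assumes e: "e \<in> F" and n: "next_above e e'" and u: "closes_wedge e e' u" and d: "d \<in> F"
    and x: "L e $ 1 < x" "x < u $ 1" "L d $ 1 < x" "x < R d $ 1"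
    and between: "g e x < g d x" "g d x < g e' x"
  shows False
proof -
  have e': "e' \<in> F" "L e' = L e" using n by (auto simp: next_above_def)
  have uR: "u $ 1 \<le> R e $ 1" "u $ 1 \<le> R e' $ 1" using u by (auto simp: closes_wedge_def)
  have le: "g e y \<le> g d y" "g d y \<le> g e' y" if "L e $ 1 \<le> y" "L d $ 1 \<le> y" "y \<le> x" for y
    using order_preserved[OF e d _ _ _ _ _ _ _ _ between(1), of y]
      order_preserved[OF d e'(1) _ _ _ _ _ _ _ _ between(2), of y] x uR e' that by auto
  consider "L d $ 1 > L e $ 1" | "L d $ 1 < L e $ 1" | "L d $ 1 = L e $ 1" by linarith
  then show False
  proof cases
    case 1
    then show False using le[of "L d $ 1"] u L_in[OF d] g_L[OF d] x by (auto simp: closes_wedge_def)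
  next
    case 2
    then show False using le[of "L e $ 1"] g_L[OF e] g_L[OF e'(1)] e' vertex_free[OF d L_in[OF e]] x by auto
  next
    case 3
    then have "g d (L d $ 1) = L e $ 2" using le[of "L e $ 1"] g_L[OF e] g_L[OF e'(1)] e' x by auto
    then have "L d = L e" using 3 g_L[OF d] by (intro vec2_eqI) auto
    then show False using n d x uR between by (auto simp: next_above_def)
  qed
qed

text \<open>This is why a vertex is charged at most twice: by one wedge whose lower edge ends at
  \<open>u\<close>, and by one whose lower edge stays below \<open>u\<close>. For two wedges of the
  same kind, the higher of the two lower edges would run inside the other wedge just before
  \<open>u\<close>.\<close>

lemma wedge_unique:
  assumes e: "e \<in> F" "next_above e e'" "closes_wedge e e' u"
    and d: "d \<in> F" "next_above d d'" "closes_wedge d d' u"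
    and side: "g e (u $ 1) = u $ 2 \<longleftrightarrow> g d (u $ 1) = u $ 2"
  shows "e = d"
proof (rule ccontr)
  assume ne: "e \<noteq> d"
  obtain x where x: "max (L e $ 1) (L d $ 1) < x" "x < u $ 1"
    using dense[of "max (L e $ 1) (L d $ 1)" "u $ 1"] e d by (auto simp: closes_wedge_def)
  have no_wedge_between: False
    if e: "e \<in> F" "next_above e e'" "closes_wedge e e' u"
      and d: "d \<in> F" "next_above d d'" "closes_wedge d d' u"
      and side: "g e (u $ 1) = u $ 2 \<longleftrightarrow> g d (u $ 1) = u $ 2"
      and x: "max (L e $ 1) (L d $ 1) < x" and less: "g e x < g d x" for e d e' d'
  proof -
    have e': "e' \<in> F" "L e' = L e" using e by (auto simp: next_above_def)
    have uR: "u \<in> V" "u $ 1 \<le> R e $ 1" "u $ 1 \<le> R e' $ 1" "u $ 1 \<le> R d $ 1" "L e $ 1 < u $ 1"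
       "g e (u $ 1) \<le> u $ 2" "u $ 2 \<le> g e' (u $ 1)" "g d (u $ 1) \<le> u $ 2" "L d $ 1 < u $ 1"
      using e d by (auto simp: closes_wedge_def)
    \<comment> \<open>If \<open>e\<close> stays below \<open>u\<close>, so does \<open>d\<close>.
      Otherwise \<open>e\<close> ends at \<open>u\<close>; then \<open>e'\<close> cannot end there
      as well, since the drawing is simple, and lies above \<open>u\<close>.\<close>
    have gd: "g d (u $ 1) < g e' (u $ 1)"
    proof (cases "g e (u $ 1) = u $ 2")
      case False
      then show ?thesis using side uR by auto
    next
      case True
      have uRe: "u = R e" using True vertex_free[OF e(1) uR(1)] uR g_R[OF e(1)] by (intro vec2_eqI) force+
      have "g e' (u $ 1) \<noteq> u $ 2"
      proof
        assume a: "g e' (u $ 1) = u $ 2"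
        then have "u $ 1 = R e' $ 1" using vertex_free[OF e'(1) uR(1)] uR e' by force
        then have "u = R e'" using a g_R[OF e'(1)] by (intro vec2_eqI) auto
        then have "e = e'" using simple[OF e(1) e'(1)] e' uRe by auto
        then have "g e x < g e x" using e(2) x(1) \<open>x < u $ 1\<close> uR by (auto simp: next_above_def)
        then show False by simp
      qed
      then show ?thesis using uR side True by auto
    qed
    have "g d x < g e' x"
      using order_preserved_strict[OF d(1) e'(1) _ _ _ _ _ _ _ _ gd, of x] uR e' x \<open>x < u $ 1\<close> by auto
    then show False
      using wedge_empty[OF e d(1), of x] x \<open>x < u $ 1\<close> uR less by auto
  qed
  have "g e x \<noteq> g d x"
    using noncrossing[OF e(1) d(1) ne, of x] x e d by (auto simp: closes_wedge_def)
  then consider "g e x < g d x" | "g d x < g e x" by linarith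
  then show False
  proof cases
    case 1 then show False using no_wedge_between[OF e d side] x by simp
  next
    case 2 then show False using no_wedge_between[OF d e] side x by (simp add: max.commute)
  qed
qed

theorem card_edges_le: "card F \<le> 3 * card V"
proof -
  have T: "card top_edges \<le> card V"
    by (rule card_inj_on_le[OF top_edges_inj _ finite_V]) (auto simp: top_edges_def L_in)
  have "\<exists>e' u. next_above e e' \<and> closes_wedge e e' u" if "e \<in> F - top_edges" for e
    using that ex_closes_wedge by (auto simp: top_edges_def)
  then obtain nx cl where nc: "\<And>e. e \<in> F - top_edges \<Longrightarrow> next_above e (nx e) \<and> closes_wedge e (nx e) (cl e)"
    by metis
  \<comment> \<open>The Boolean separates the two kinds of wedge that a vertex may close.\<close>
  have "inj_on (\<lambda>e. (cl e, g e (cl e $ 1) = cl e $ 2)) (F - top_edges)"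
  proof (rule inj_onI)
    fix e d
    assume e: "e \<in> F - top_edges" and d: "d \<in> F - top_edges"
      and eq: "(cl e, g e (cl e $ 1) = cl e $ 2) = (cl d, g d (cl d $ 1) = cl d $ 2)"
    then have "cl d = cl e" by simp
    then show "e = d" using nc[OF e] nc[OF d] e d eq
      by (intro wedge_unique[of e "nx e" "cl e" d "nx d"]) auto
  qed
  moreover have "(\<lambda>e. (cl e, g e (cl e $ 1) = cl e $ 2)) ` (F - top_edges) \<subseteq> V \<times> UNIV"
    using nc by (auto simp: closes_wedge_def)
  ultimately have "card (F - top_edges) \<le> card (V \<times> (UNIV :: bool set))"
    using finite_V by (intro card_inj_on_le) auto
  then have "card (F - top_edges) \<le> 2 * card V" by (simp add: card_cartesian_product)
  moreover have "card F = card top_edges + card (F - top_edges)"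
    using finite_F card_Diff_subset[of top_edges F] card_mono[of F top_edges]
    by (auto simp: top_edges_def)
  ultimately show ?thesis using T by simp
qed

end

section \<open>Incidences with pseudo-segments\<close>

lemma card_PiE_fixed:
  assumes "finite V" "T \<subseteq> V" "s > 0"
  shows "card {f \<in> V \<rightarrow>\<^sub>E {..<s}. \<forall>v\<in>T. f v = (0::nat)} * s ^ card T = s ^ card V"
proof -
  have T: "finite T" using assms finite_subset by blast
  have "{f \<in> V \<rightarrow>\<^sub>E {..<s}. \<forall>v\<in>T. f v = 0} = (\<Pi>\<^sub>E v\<in>V. if v \<in> T then {0} else {..<s})"
  proof (intro equalityI subsetI)
    fix f assume f: "f \<in> (\<Pi>\<^sub>E v\<in>V. if v \<in> T then {0} else {..<s})"
    have fv: "f v \<in> (if v \<in> T then {0} else {..<s})" if "v \<in> V" for v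
      using f that by (rule PiE_mem)
    have "f v < s" if "v \<in> V" for v
      using fv[OF that] assms(3) by (cases "v \<in> T") auto
    moreover have "f v = 0" if "v \<in> T" for v
      using fv[of v] that assms(2) by auto
    ultimately show "f \<in> {f \<in> V \<rightarrow>\<^sub>E {..<s}. \<forall>v\<in>T. f v = 0}"
      using f by (auto simp: PiE_iff)
  qed (auto simp: PiE_iff)
  then have "card {f \<in> V \<rightarrow>\<^sub>E {..<s}. \<forall>v\<in>T. f v = 0} = (\<Prod>v\<in>V. if v \<in> T then 1 else s)"
    using assms by (auto simp: card_PiE intro!: prod.cong)
  also have "\<dots> = (\<Prod>v\<in>V - T. s)"
    using assms by (intro prod.mono_neutral_cong_right) auto
  finally show ?thesis
    using assms T by (simp add: card_Diff_subset card_mono flip: power_add)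
qed

text \<open>A map \<open>f\<close> selects the vertices of value 0, each independently with
  probability \<open>1 / s\<close>. An object on \<open>j\<close> vertices therefore survives in the
  fraction \<open>1 / s ^ j\<close> of all samples. Multiplying out keeps the count in the
  naturals.\<close>

lemma sum_card_sampled:
  assumes V: "finite V" "s > 0" and A: "finite A" and T: "\<And>a. a \<in> A \<Longrightarrow> T a \<subseteq> V \<and> card (T a) = j"
  shows "(\<Sum>f\<in>V \<rightarrow>\<^sub>E {..<s}. card {a\<in>A. \<forall>v\<in>T a. f v = (0::nat)}) * s ^ j = card A * s ^ card V"
proof -
  have fin: "finite (V \<rightarrow>\<^sub>E {..<s})" using V by (intro finite_PiE) auto
  have "(\<Sum>f\<in>V \<rightarrow>\<^sub>E {..<s}. card {a\<in>A. \<forall>v\<in>T a. f v = (0::nat)})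
      = (\<Sum>f\<in>V \<rightarrow>\<^sub>E {..<s}. \<Sum>a\<in>A. if \<forall>v\<in>T a. f v = 0 then 1 else 0)"
    using A by (simp add: sum.If_cases Int_def)
  also have "\<dots> = (\<Sum>a\<in>A. \<Sum>f\<in>V \<rightarrow>\<^sub>E {..<s}. if \<forall>v\<in>T a. f v = 0 then 1 else 0)"
    by (rule sum.swap)
  also have "\<dots> = (\<Sum>a\<in>A. card {f \<in> V \<rightarrow>\<^sub>E {..<s}. \<forall>v\<in>T a. f v = 0})"
    using fin by (simp add: sum.If_cases Int_def)
  also have "\<dots> * s ^ j = (\<Sum>a\<in>A. card {f \<in> V \<rightarrow>\<^sub>E {..<s}. \<forall>v\<in>T a. f v = 0} * s ^ card (T a))"
    using T by (simp add: sum_distrib_right)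
  also have "\<dots> = (\<Sum>a\<in>A. s ^ card V)"
    using T V by (intro sum.cong refl card_PiE_fixed) auto
  finally show ?thesis by simp
qed

section \<open>Arcs between consecutive points and their crossings\<close>

locale pseudo_segments =
  fixes P :: "(real^2) set" and Q :: "'q set" and lo hi :: "'q \<Rightarrow> real" and g :: "'q \<Rightarrow> real \<Rightarrow> real"
  assumes finite_P: "finite P" and finite_Q: "finite Q"
    and cont: "q \<in> Q \<Longrightarrow> continuous_on {lo q..hi q} (g q)"
    and meet_once: "q \<in> Q \<Longrightarrow> q' \<in> Q \<Longrightarrow> q \<noteq> q' \<Longrightarrow>
      x \<in> {lo q..hi q} \<inter> {lo q'..hi q'} \<Longrightarrow> x' \<in> {lo q..hi q} \<inter> {lo q'..hi q'} \<Longrightarrow>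
      g q x = g q' x \<Longrightarrow> g q x' = g q' x' \<Longrightarrow> x = x'"
begin

definition on :: "'q \<Rightarrow> (real^2) set" where
  "on q = {p\<in>P. lo q \<le> p $ 1 \<and> p $ 1 \<le> hi q \<and> g q (p $ 1) = p $ 2}"

definition incidences :: "('q \<times> (real^2)) set" where
  "incidences = {(q, p). q \<in> Q \<and> p \<in> on q}"

text \<open>An arc between consecutive points of a curve is represented by the curve and its left endpoint.\<close>

definition arcs :: "('q \<times> (real^2)) set" where
  "arcs = {(q, p). q \<in> Q \<and> p \<in> on q \<and> (\<exists>p'\<in>on q. p $ 1 < p' $ 1)}"

text \<open>The choice is meaningful for arcs only, where finiteness of \<open>on\<close> supplies a
  nearest point to the right.\<close>

definition right_end :: "'q \<times> (real^2) \<Rightarrow> real^2" where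
  "right_end e = (SOME p'. p' \<in> on (fst e) \<and> snd e $ 1 < p' $ 1 \<and>
     (\<forall>r\<in>on (fst e). snd e $ 1 < r $ 1 \<longrightarrow> p' $ 1 \<le> r $ 1))"

definition crosses_at :: "'q \<times> (real^2) \<Rightarrow> 'q \<times> (real^2) \<Rightarrow> real \<Rightarrow> bool" where
  "crosses_at e d x \<longleftrightarrow> fst e \<noteq> fst d \<and> snd e $ 1 < x \<and> x < right_end e $ 1 \<and>
     snd d $ 1 < x \<and> x < right_end d $ 1 \<and> g (fst e) x = g (fst d) x"

text \<open>Pairs are ordered, so a crossing is counted in both orders;
  \<open>card_crossings_le\<close> accordingly compares with all ordered pairs of curves.\<close>

definition crossings :: "(('q \<times> (real^2)) \<times> ('q \<times> (real^2))) set" where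
  "crossings = {(e, d). e \<in> arcs \<and> d \<in> arcs \<and> (\<exists>x. crosses_at e d x)}"

lemma on_eqI: "p \<in> on q \<Longrightarrow> r \<in> on q \<Longrightarrow> p $ 1 = r $ 1 \<Longrightarrow> p = r"
  by (auto simp: on_def intro!: vec2_eqI)

lemma finite_on: "finite (on q)" using finite_P by (auto simp: on_def)

lemma finite_incidences: "finite incidences"
  by (rule finite_subset[of _ "Q \<times> P"]) (auto simp: incidences_def on_def finite_P finite_Q)

lemma arcs_subset: "arcs \<subseteq> incidences" by (auto simp: arcs_def incidences_def)

lemma finite_arcs: "finite arcs" using finite_subset[OF arcs_subset finite_incidences] .

lemma finite_crossings: "finite crossings"
  by (rule finite_subset[of _ "arcs \<times> arcs"]) (auto simp: crossings_def finite_arcs)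

lemma arcD:
  assumes "e \<in> arcs"
  shows "fst e \<in> Q" "snd e \<in> on (fst e)" "right_end e \<in> on (fst e)" "snd e $ 1 < right_end e $ 1"
    "\<And>r. r \<in> on (fst e) \<Longrightarrow> snd e $ 1 < r $ 1 \<Longrightarrow> right_end e $ 1 \<le> r $ 1"
    "snd e \<in> P" "right_end e \<in> P"
proof -
  define S where "S = {r\<in>on (fst e). snd e $ 1 < r $ 1}"
  have S: "finite S" "S \<noteq> {}" using assms finite_on by (auto simp: S_def arcs_def)
  obtain p' where "p' \<in> S" "\<And>r. r \<in> S \<Longrightarrow> p' $ 1 \<le> r $ 1"
    using ex_is_arg_min_if_finite[OF S, of "\<lambda>v. v $ 1"] by (auto simp: is_arg_min_linorder)
  then have "\<exists>p'. p' \<in> on (fst e) \<and> snd e $ 1 < p' $ 1 \<and>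
     (\<forall>r\<in>on (fst e). snd e $ 1 < r $ 1 \<longrightarrow> p' $ 1 \<le> r $ 1)" by (auto simp: S_def)
  from someI_ex[OF this] have *: "right_end e \<in> on (fst e) \<and> snd e $ 1 < right_end e $ 1 \<and>
     (\<forall>r\<in>on (fst e). snd e $ 1 < r $ 1 \<longrightarrow> right_end e $ 1 \<le> r $ 1)"
    unfolding right_end_def .
  then show "right_end e \<in> on (fst e)" "snd e $ 1 < right_end e $ 1"
    "\<And>r. r \<in> on (fst e) \<Longrightarrow> snd e $ 1 < r $ 1 \<Longrightarrow> right_end e $ 1 \<le> r $ 1" "right_end e \<in> P"
    by (auto simp: on_def)
  show "fst e \<in> Q" "snd e \<in> on (fst e)" "snd e \<in> P" using assms by (auto simp: arcs_def on_def)
qed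

lemma arc_domain: "e \<in> arcs \<Longrightarrow> {snd e $ 1..right_end e $ 1} \<subseteq> {lo (fst e)..hi (fst e)}"
  using arcD(2,3)[of e] by (auto simp: on_def)

text \<open>If the left ends differed, one of them would be a point of the curve inside the other
  arc, which joins consecutive points.\<close>

lemma arcs_same_curve_disjoint:
  assumes "e \<in> arcs" "d \<in> arcs" "fst e = fst d"
    "snd e $ 1 < x" "x < right_end e $ 1" "snd d $ 1 < x" "x < right_end d $ 1"
  shows "e = d"
proof -
  have "snd e $ 1 = snd d $ 1"
    using arcD(5)[OF assms(1), of "snd d"] arcD(5)[OF assms(2), of "snd e"] arcD(2)[OF assms(1)] arcD(2)[OF assms(2)] assms
    by force
  then show ?thesis using on_eqI arcD(2) assms by (metis prod_eqI)
qed

text \<open>An incidence that starts no arc sits at the rightmost point of its curve, so each curve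
  has at most one.\<close>

lemma card_incidences_le: "card incidences \<le> card Q + card arcs"
proof -
  have "inj_on fst (incidences - arcs)"
  proof (rule inj_onI)
    fix a b assume a: "a \<in> incidences - arcs" and b: "b \<in> incidences - arcs" and eq: "fst a = fst b"
    have "snd a $ 1 = snd b $ 1"
      using a b eq by (auto simp: incidences_def arcs_def) (meson linorder_neqE_linordered_idom)
    then show "a = b" using a b eq by (auto simp: incidences_def intro!: prod_eqI on_eqI)
  qed
  then have "card (incidences - arcs) \<le> card Q"
    by (rule card_inj_on_le) (auto simp: incidences_def finite_Q)
  then show ?thesis
    using card_Diff_subset[OF finite_arcs arcs_subset] card_mono[OF finite_incidences arcs_subset] by simp
qed

text \<open>Two distinct curves meet at one abscissa at most, and on each curve only one arc has it
  in its interior. So a crossing pair of arcs is determined by its pair of curves.\<close>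

lemma card_crossings_le: "card crossings \<le> card Q ^ 2"
proof -
  have "inj_on (\<lambda>(e, d). (fst e, fst d)) crossings"
  proof (rule inj_onI)
    fix a b assume a: "a \<in> crossings" and b: "b \<in> crossings"
      and eq: "(\<lambda>(e, d). (fst e, fst d)) a = (\<lambda>(e, d). (fst e, fst d)) b"
    obtain e d where ed: "a = (e, d)" by (cases a)
    obtain e' d' where ed': "b = (e', d')" by (cases b)
    obtain x where x: "crosses_at e d x" using a ed by (auto simp: crossings_def)
    obtain y where y: "crosses_at e' d' y" using b ed' by (auto simp: crossings_def)
    have A: "e \<in> arcs" "d \<in> arcs" "e' \<in> arcs" "d' \<in> arcs"
      using a b ed ed' by (auto simp: crossings_def)
    have f: "fst e' = fst e" "fst d' = fst d" using eq ed ed' by auto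
    have "x = y"
      using A[THEN arc_domain] A[THEN arcD(1)] x y f
      by (intro meet_once[of "fst e" "fst d" x y]) (auto simp: crosses_at_def subset_iff)
    then have "e = e'" and "d = d'"
      using x y unfolding crosses_at_def
      by (blast intro: arcs_same_curve_disjoint A f[symmetric])+
    then show "a = b" using ed ed' by simp
  qed
  then have "card crossings \<le> card (Q \<times> Q)"
    by (rule card_inj_on_le) (auto simp: crossings_def arcs_def finite_Q)
  then show ?thesis by (simp add: card_cartesian_product power2_eq_square)
qed

text \<open>A common end of the two arcs would be a second meeting of their curves, besides the
  interior one at \<open>x\<close>. Having four distinct ends is what makes a crossing survive
  sampling only at the rate \<open>1 / s ^ 4\<close>.\<close>

lemma crossing_no_shared_vertex:
  assumes "(e, d) \<in> crossings"
  shows "card {snd e, right_end e, snd d, right_end d} = 4"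
proof -
  have ed: "e \<in> arcs" "d \<in> arcs" using assms by (auto simp: crossings_def)
  obtain x where x: "crosses_at e d x" using assms by (auto simp: crossings_def)
  have no: "v $ 1 = x" if "v \<in> on (fst e)" "v \<in> on (fst d)" for v
    using that ed[THEN arc_domain] ed[THEN arcD(1)] x
    by (intro meet_once[of "fst e" "fst d" "v $ 1" x]) (auto simp: crosses_at_def on_def subset_iff)
  have "snd e \<noteq> right_end e" "snd d \<noteq> right_end d" using ed[THEN arcD(4)] by auto
  moreover have "snd e \<noteq> snd d" "snd e \<noteq> right_end d" "right_end e \<noteq> snd d" "right_end e \<noteq> right_end d"
    using no ed[THEN arcD(2)] ed[THEN arcD(3)] x unfolding crosses_at_def by (metis less_irrefl)+
  ultimately show ?thesis by simp
qed

section \<open>The crossing inequality by sampling, and the incidence bound\<close>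

lemma card_induced_arcs_le:
  assumes S: "S \<subseteq> P"
  shows "card {e\<in>arcs. snd e \<in> S \<and> right_end e \<in> S} \<le> 3 * card S +
    card {(e, d)\<in>crossings. snd e \<in> S \<and> right_end e \<in> S \<and> snd d \<in> S \<and> right_end d \<in> S}" (is "card ?E \<le> 3 * card S + card ?X")
proof -
  have fin: "finite ?X" by (rule finite_subset[OF _ finite_crossings]) auto
  have finE: "finite ?E" using finite_arcs by auto
  \<comment> \<open>Removing the first arc of every crossing pair within \<open>S\<close> leaves a
    crossing-free drawing, to which the linear edge bound applies.\<close>
  interpret noncrossing_drawing S "?E - fst ` ?X" snd right_end "\<lambda>e. g (fst e)"
  proof
    show "finite S" using S finite_P finite_subset by blast
    show "finite (?E - fst ` ?X)" using finE by auto
    fix e assume e: "e \<in> ?E - fst ` ?X"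
    then have ea: "e \<in> arcs" by auto
    show "snd e \<in> S" "right_end e \<in> S" using e by auto
    show "snd e $ 1 < right_end e $ 1" using arcD[OF ea] by auto
    show "continuous_on {snd e $ 1..right_end e $ 1} (g (fst e))"
      using continuous_on_subset[OF cont arc_domain] arcD[OF ea] ea by auto
    show "g (fst e) (snd e $ 1) = snd e $ 2" "g (fst e) (right_end e $ 1) = right_end e $ 2"
      using arcD(2,3)[OF ea] by (auto simp: on_def)
    show "g (fst e) (v $ 1) \<noteq> v $ 2" if "v \<in> S" "snd e $ 1 < v $ 1" "v $ 1 < right_end e $ 1" for v
    proof
      assume "g (fst e) (v $ 1) = v $ 2"
      then have "v \<in> on (fst e)" using arc_domain[OF ea] that S by (auto simp: on_def subset_iff)
      then show False using arcD(5)[OF ea] that by force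
    qed
    fix d assume d: "d \<in> ?E - fst ` ?X"
    then have da: "d \<in> arcs" by auto
    show "g (fst e) x \<noteq> g (fst d) x"
      if "e \<noteq> d" "snd e $ 1 < x" "x < right_end e $ 1" "snd d $ 1 < x" "x < right_end d $ 1" for x
    proof
      assume eq: "g (fst e) x = g (fst d) x"
      have "fst e \<noteq> fst d" using arcs_same_curve_disjoint[OF ea da] that by blast
      then have "crosses_at e d x" using that eq by (auto simp: crosses_at_def)
      then have "(e, d) \<in> ?X" using e d ea da by (auto simp: crossings_def)
      then have "fst (e, d) \<in> fst ` ?X" by (rule imageI)
      then show False using e by simp
    qed
    \<comment> \<open>Arcs of different curves with the same two ends would make these curves meet
      twice.\<close>
    show "e = d" if eq: "snd e = snd d" "right_end e = right_end d"
    proof (cases "fst e = fst d")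
      case True then show ?thesis using eq by (simp add: prod_eqI)
    next
      case False
      have "snd e $ 1 = right_end e $ 1"
      proof (rule meet_once[OF arcD(1)[OF ea] arcD(1)[OF da] False])
        have "snd e \<in> on (fst d)" "right_end e \<in> on (fst d)"
          unfolding eq by (rule arcD[OF da])+
        then show "snd e $ 1 \<in> {lo (fst e)..hi (fst e)} \<inter> {lo (fst d)..hi (fst d)}"
          "right_end e $ 1 \<in> {lo (fst e)..hi (fst e)} \<inter> {lo (fst d)..hi (fst d)}"
          "g (fst e) (snd e $ 1) = g (fst d) (snd e $ 1)"
          "g (fst e) (right_end e $ 1) = g (fst d) (right_end e $ 1)"
          using arcD(2,3)[OF ea] by (simp_all add: on_def)
      qed
      then show ?thesis using arcD(4)[OF ea] by simp
    qed
  qed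
  have "card ?E \<le> card (?E - fst ` ?X) + card (fst ` ?X)"
    using diff_card_le_card_Diff[of "fst ` ?X" ?E] fin by simp
  also have "card (fst ` ?X) \<le> card ?X" using fin by (rule card_image_le)
  finally show ?thesis using card_edges_le by linarith
qed

text \<open>For \<open>a\<close> arcs, \<open>p\<close> points and \<open>x\<close> crossings,
  averaging \<open>card_induced_arcs_le\<close> over all samples gives
  \<open>a / s^2 \<le> 3 * p / s + x / s^4\<close>. Multiply by \<open>s^4\<close> and insert
  \<open>card_crossings_le\<close>.\<close>

lemma card_arcs_sampled:
  assumes "s > 0"
  shows "card arcs * s ^ 2 \<le> 3 * card P * s ^ 3 + card Q ^ 2"
proof -
  define T where "T = (\<lambda>e. {snd e, right_end e})"
  define TT where "TT = (\<lambda>(e, d). {snd e, right_end e, snd d, right_end d})"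
  define N where "N = s ^ card P"
  let ?Ph = "P \<rightarrow>\<^sub>E {..<s}"
  have E: "(\<Sum>f\<in>?Ph. card {a\<in>arcs. \<forall>v\<in>T a. f v = (0::nat)}) * s ^ 2 = card arcs * N" (is "?e * _ = _")
    unfolding N_def
  proof (intro sum_card_sampled finite_P assms finite_arcs conjI)
    fix e assume e: "e \<in> arcs"
    then have "snd e \<noteq> right_end e" using arcD(4)[OF e] by auto
    then show "card (T e) = 2" by (simp add: T_def)
    show "T e \<subseteq> P" using arcD(6,7)[OF e] by (simp add: T_def)
  qed
  have X: "(\<Sum>f\<in>?Ph. card {a\<in>crossings. \<forall>v\<in>TT a. f v = (0::nat)}) * s ^ 4 = card crossings * N" (is "?x * _ = _")
    unfolding N_def
  proof (intro sum_card_sampled finite_P assms finite_crossings)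
    fix a assume a: "a \<in> crossings"
    obtain e d where ed: "a = (e, d)" by (cases a)
    then have "e \<in> arcs" "d \<in> arcs" using a by (auto simp: crossings_def)
    then show "TT a \<subseteq> P \<and> card (TT a) = 4"
      using crossing_no_shared_vertex[of e d] arcD(6,7)[of e] arcD(6,7)[of d] a ed by (simp add: TT_def)
  qed
  have V: "(\<Sum>f\<in>?Ph. card {a\<in>P. \<forall>v\<in>{a}. f v = (0::nat)}) * s ^ 1 = card P * N" (is "?v * _ = _")
    unfolding N_def by (intro sum_card_sampled finite_P assms) auto
  have "?e \<le> (\<Sum>f\<in>?Ph. 3 * card {a\<in>P. \<forall>v\<in>{a}. f v = (0::nat)} + card {a\<in>crossings. \<forall>v\<in>TT a. f v = (0::nat)})"
  proof (rule sum_mono)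
    fix f assume "f \<in> ?Ph"
    have *: "{e\<in>arcs. \<forall>v\<in>T e. f v = 0} = {e\<in>arcs. snd e \<in> {p\<in>P. f p = 0} \<and> right_end e \<in> {p\<in>P. f p = 0}}"
      using arcD by (auto simp: T_def)
    have **: "{a\<in>crossings. \<forall>v\<in>TT a. f v = 0} = {(e, d)\<in>crossings. snd e \<in> {p\<in>P. f p = 0} \<and> right_end e \<in> {p\<in>P. f p = 0}
       \<and> snd d \<in> {p\<in>P. f p = 0} \<and> right_end d \<in> {p\<in>P. f p = 0}}"
      using arcD(6,7) by (auto simp: TT_def crossings_def)
    show "card {a\<in>arcs. \<forall>v\<in>T a. f v = (0::nat)} \<le> 3 * card {a\<in>P. \<forall>v\<in>{a}. f v = (0::nat)} + card {a\<in>crossings. \<forall>v\<in>TT a. f v = (0::nat)}"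
      unfolding * ** using card_induced_arcs_le[of "{p\<in>P. f p = 0}"] by simp
  qed
  also have "\<dots> = 3 * ?v + ?x" by (simp add: sum.distrib sum_distrib_left)
  finally have "?e * s ^ 4 \<le> (3 * ?v + ?x) * s ^ 4" by (rule mult_right_mono) simp
  moreover have "?e * s ^ 4 = (?e * s ^ 2) * s ^ 2" by (simp flip: power_add add: mult.assoc)
  moreover have "(3 * ?v + ?x) * s ^ 4 = 3 * (?v * s ^ 1) * s ^ 3 + ?x * s ^ 4"
    by (simp add: algebra_simps power_numeral_reduce)
  ultimately have "card arcs * N * s ^ 2 \<le> 3 * (card P * N) * s ^ 3 + card crossings * N"
    unfolding E X V by simp
  then have "(card arcs * s ^ 2) * N \<le> (3 * card P * s ^ 3 + card crossings) * N"
    by (simp add: algebra_simps)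
  then have "card arcs * s ^ 2 \<le> 3 * card P * s ^ 3 + card crossings"
    using assms by (simp add: N_def)
  then show ?thesis using card_crossings_le by linarith
qed

lemma card_arcs_le: "card arcs \<le> 6 * card P \<or> card arcs ^ 3 \<le> 288 * card P ^ 2 * card Q ^ 2"
proof (cases "card arcs \<le> 6 * card P")
  case False
  have v: "card P > 0"
  proof (rule ccontr)
    assume "\<not> card P > 0"
    then have "P = {}" using finite_P by simp
    then have "arcs = {}" using arcD(6) by blast
    then show False using False by simp
  qed
  \<comment> \<open>This sampling rate makes the vertex term \<open>3 * card P * s ^ 3\<close> at
    most half of \<open>card arcs * s ^ 2\<close>. Rounding down costs the factor two in
    \<open>s2\<close>.\<close>
  define s where "s = card arcs div (6 * card P)"
  have s: "s > 0" using False v by (simp add: s_def div_greater_zero_iff)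
  have s1: "6 * card P * s \<le> card arcs" by (simp add: s_def)
  have "card arcs < 6 * card P * (s + 1)"
    using v unfolding s_def by (metis Suc_eq_plus1 dividend_less_times_div mult_Suc_right mult_pos_pos zero_less_numeral add.commute)
  also have "\<dots> \<le> 12 * card P * s" using s by (cases s) auto
  finally have s2: "card arcs \<le> 12 * card P * s" by simp
  have "6 * card P * s * s ^ 2 \<le> card arcs * s ^ 2" using s1 by (rule mult_right_mono) simp
  moreover have "6 * card P * s * s ^ 2 = 2 * (3 * card P * s ^ 3)" by (simp add: power_numeral_reduce)
  ultimately have e: "card arcs * s ^ 2 \<le> 2 * card Q ^ 2"
    using card_arcs_sampled[OF s] by linarith
  have "card arcs ^ 3 = card arcs * card arcs ^ 2" by (simp add: power_numeral_reduce)
  also have "\<dots> \<le> card arcs * (12 * card P * s) ^ 2" using s2 by (intro mult_left_mono power_mono) auto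
  also have "\<dots> = 144 * card P ^ 2 * (card arcs * s ^ 2)" by (simp add: power_mult_distrib algebra_simps)
  also have "\<dots> \<le> 144 * card P ^ 2 * (2 * card Q ^ 2)" using e by (rule mult_left_mono) simp
  finally show ?thesis by simp
qed simp

theorem incidence_bound:
  "card incidences \<le> 2 * card Q + 12 * card P \<or> card incidences ^ 3 \<le> 2304 * card P ^ 2 * card Q ^ 2"
proof (cases "card arcs \<le> card Q \<or> card arcs \<le> 6 * card P")
  case True
  then show ?thesis using card_incidences_le by linarith
next
  case False
  \<comment> \<open>With more arcs than curves, passing from arcs to incidences costs a factor two,
    hence 8 in the cube: \<open>2304 = 8 * 288\<close>.\<close>
  then have "card incidences \<le> 2 * card arcs" using card_incidences_le by linarith
  then have "card incidences ^ 3 \<le> (2 * card arcs) ^ 3" by (rule power_mono) simp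
  then show ?thesis using False card_arcs_le by (auto simp: power_mult_distrib)
qed

end

section \<open>Circles of equal radius\<close>

lemma dist_vec2: "dist p q = sqrt ((p $ 1 - q $ 1)\<^sup>2 + (p $ 2 - q $ 2)\<^sup>2)" for p q :: "real^2"
  by (simp add: dist_vec_def L2_set_def UNIV_2 dist_real_def)

lemma dist_vec2_eq_iff:
  fixes p q :: "real^2"
  assumes "r \<ge> 0"
  shows "dist p q = r \<longleftrightarrow> (p $ 1 - q $ 1)\<^sup>2 + (p $ 2 - q $ 2)\<^sup>2 = r\<^sup>2"
proof -
  have "dist p q = r \<longleftrightarrow> (dist p q)\<^sup>2 = r\<^sup>2" using assms by (simp add: power2_eq_iff_nonneg)
  then show ?thesis by (simp add: dist_vec2)
qed

text \<open>The chord \<open>(u, v)\<close> is perpendicular to \<open>(A, B)\<close>, twice the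
  vector from the centre to the midpoint of the chord, and the length of \<open>(A, B)\<close> is
  fixed by chord and radius. So \<open>(A, B)\<close> is known up to sign, and the side
  \<open>\<sigma>\<close> settles the sign.\<close>

lemma semicircle_centre_unique:
  fixes \<sigma> :: real
  assumes \<sigma>: "\<sigma> = 1 \<or> \<sigma> = -1" and x: "x1 \<noteq> x2"
    and c: "(x1 - a)\<^sup>2 + (y1 - b)\<^sup>2 = d" "(x2 - a)\<^sup>2 + (y2 - b)\<^sup>2 = d"
    and c': "(x1 - a')\<^sup>2 + (y1 - b')\<^sup>2 = d" "(x2 - a')\<^sup>2 + (y2 - b')\<^sup>2 = d"
    and s: "\<sigma> * (y1 - b) \<ge> 0" "\<sigma> * (y2 - b) \<ge> 0" "\<sigma> * (y1 - b') \<ge> 0" "\<sigma> * (y2 - b') \<ge> 0"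
  shows "a = a' \<and> b = b'"
proof -
  define u v A B A' B' where "u = x2 - x1" and "v = y2 - y1" and "A = x1 + x2 - 2 * a" and "B = y1 + y2 - 2 * b"
    and "A' = x1 + x2 - 2 * a'" and "B' = y1 + y2 - 2 * b'"
  note defs = u_def v_def A_def B_def A'_def B'_def
  have 1: "u * A = - (v * B)" using c unfolding defs by (simp add: power2_eq_square algebra_simps)
  have 2: "u * A' = - (v * B')" using c' unfolding defs by (simp add: power2_eq_square algebra_simps)
  have 3: "A\<^sup>2 + B\<^sup>2 = A'\<^sup>2 + B'\<^sup>2" using c c' unfolding defs by (simp add: power2_eq_square algebra_simps)
  have u: "u \<noteq> 0" using x by (simp add: u_def)
  have "u\<^sup>2 * (A\<^sup>2 + B\<^sup>2) = (u * A)\<^sup>2 + u\<^sup>2 * B\<^sup>2" by (simp add: algebra_simps power_mult_distrib)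
  then have "u\<^sup>2 * (A\<^sup>2 + B\<^sup>2) = (u\<^sup>2 + v\<^sup>2) * B\<^sup>2" unfolding 1 by (simp add: algebra_simps power_mult_distrib)
  moreover have "u\<^sup>2 * (A'\<^sup>2 + B'\<^sup>2) = (u * A')\<^sup>2 + u\<^sup>2 * B'\<^sup>2" by (simp add: algebra_simps power_mult_distrib)
  then have "u\<^sup>2 * (A'\<^sup>2 + B'\<^sup>2) = (u\<^sup>2 + v\<^sup>2) * B'\<^sup>2" unfolding 2 by (simp add: algebra_simps power_mult_distrib)
  ultimately have "(u\<^sup>2 + v\<^sup>2) * B\<^sup>2 = (u\<^sup>2 + v\<^sup>2) * B'\<^sup>2" using 3 by metis
  moreover have "u\<^sup>2 + v\<^sup>2 \<noteq> 0" using u by simp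
  ultimately have "B\<^sup>2 = B'\<^sup>2" using mult_left_cancel by blast
  then have "B = B' \<or> B = - B'" by (rule power2_eq_iff[THEN iffD1])
  moreover have "\<sigma> * B \<ge> 0" "\<sigma> * B' \<ge> 0" using s unfolding defs by (auto simp: algebra_simps)
  ultimately have B: "B = B'" using \<sigma> by auto
  then have "u * A = u * A'" using 1 2 by simp
  then show ?thesis using B u unfolding A_def A'_def B_def B'_def by simp
qed

definition semicircle :: "real \<Rightarrow> real \<Rightarrow> real^2 \<Rightarrow> real \<Rightarrow> real" where
  "semicircle \<sigma> \<delta> q x = q $ 2 + \<sigma> * sqrt (\<delta>\<^sup>2 - (x - q $ 1)\<^sup>2)"

lemma semicircleD:
  assumes \<sigma>: "\<sigma> = 1 \<or> \<sigma> = -1" and x: "x \<in> {q $ 1 - \<delta>..q $ 1 + \<delta>}"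
  shows "(x - q $ 1)\<^sup>2 + (semicircle \<sigma> \<delta> q x - q $ 2)\<^sup>2 = \<delta>\<^sup>2" "\<sigma> * (semicircle \<sigma> \<delta> q x - q $ 2) \<ge> 0"
proof -
  have "(x - q $ 1)\<^sup>2 \<le> \<delta>\<^sup>2" using x by (simp add: abs_le_square_iff[symmetric] abs_le_iff)
  then show "(x - q $ 1)\<^sup>2 + (semicircle \<sigma> \<delta> q x - q $ 2)\<^sup>2 = \<delta>\<^sup>2"
    "\<sigma> * (semicircle \<sigma> \<delta> q x - q $ 2) \<ge> 0"
    using \<sigma> by (auto simp: semicircle_def)
qed

text \<open>Two meeting points of semicircles on the same side would determine a common centre by
  \<open>semicircle_centre_unique\<close>.\<close>

lemma pseudo_segments_semicircles:
  assumes "finite P" "finite Q" and \<sigma>: "\<sigma> = 1 \<or> \<sigma> = -1"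
  shows "pseudo_segments P Q (\<lambda>q. q $ 1 - \<delta>) (\<lambda>q. q $ 1 + \<delta>) (semicircle \<sigma> \<delta>)"
proof
  show "continuous_on {q $ 1 - \<delta>..q $ 1 + \<delta>} (semicircle \<sigma> \<delta> q)" for q :: "real^2"
    unfolding semicircle_def by (intro continuous_intros)
  fix q q' :: "real^2" and x x'
  assume ne: "q \<noteq> q'" and x: "x \<in> {q $ 1 - \<delta>..q $ 1 + \<delta>} \<inter> {q' $ 1 - \<delta>..q' $ 1 + \<delta>}"
    "x' \<in> {q $ 1 - \<delta>..q $ 1 + \<delta>} \<inter> {q' $ 1 - \<delta>..q' $ 1 + \<delta>}"
    and eq: "semicircle \<sigma> \<delta> q x = semicircle \<sigma> \<delta> q' x" "semicircle \<sigma> \<delta> q x' = semicircle \<sigma> \<delta> q' x'"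
  show "x = x'"
  proof (rule ccontr)
    assume "x \<noteq> x'"
    then have "q $ 1 = q' $ 1 \<and> q $ 2 = q' $ 2"
      using semicircleD[OF \<sigma>, of x q \<delta>] semicircleD[OF \<sigma>, of x' q \<delta>]
        semicircleD[OF \<sigma>, of x q' \<delta>] semicircleD[OF \<sigma>, of x' q' \<delta>] x eq
      by (intro semicircle_centre_unique[OF \<sigma>, of x x' "q $ 1" "semicircle \<sigma> \<delta> q x" "q $ 2" "\<delta>\<^sup>2"
            "semicircle \<sigma> \<delta> q x'" "q' $ 1" "q' $ 2"]) auto
    then show False using ne vec2_eqI by blast
  qed
qed (use assms in auto)

text \<open>Every incidence lies on an upper or a lower semicircle, so one side carries at least
  half of them. This doubles the linear bound and multiplies the cubic one by 8.\<close>

theorem distance_incidence_bound: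
  fixes P Q :: "(real^2) set"
  assumes fin: "finite P" "finite Q" and \<delta>: "\<delta> > 0"
  defines "I \<equiv> card {(q, p). q \<in> Q \<and> p \<in> P \<and> dist q p = \<delta>}"
  shows "I \<le> 4 * card Q + 24 * card P \<or> I ^ 3 \<le> 18432 * card P ^ 2 * card Q ^ 2"
proof -
  define J where "J = (\<lambda>\<sigma>. pseudo_segments.incidences P Q (\<lambda>q. q $ 1 - \<delta>) (\<lambda>q. q $ 1 + \<delta>) (semicircle \<sigma> \<delta>))"
  have ps: "pseudo_segments P Q (\<lambda>q. q $ 1 - \<delta>) (\<lambda>q. q $ 1 + \<delta>) (semicircle \<sigma> \<delta>)"
    if "\<sigma> = 1 \<or> \<sigma> = -1" for \<sigma> using pseudo_segments_semicircles[OF fin that] .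
  have J: "finite (J \<sigma>)" "card (J \<sigma>) \<le> 2 * card Q + 12 * card P \<or> card (J \<sigma>) ^ 3 \<le> 2304 * card P ^ 2 * card Q ^ 2"
    "J \<sigma> = {(q, p). q \<in> Q \<and> p \<in> P \<and> q $ 1 - \<delta> \<le> p $ 1 \<and> p $ 1 \<le> q $ 1 + \<delta> \<and> semicircle \<sigma> \<delta> q (p $ 1) = p $ 2}"
    if "\<sigma> = 1 \<or> \<sigma> = -1" for \<sigma>
    using pseudo_segments.finite_incidences[OF ps[OF that]] pseudo_segments.incidence_bound[OF ps[OF that]]
      pseudo_segments.incidences_def[OF ps[OF that]] pseudo_segments.on_def[OF ps[OF that]]
    by (auto simp: J_def)
  have "{(q, p). q \<in> Q \<and> p \<in> P \<and> dist q p = \<delta>} \<subseteq> J 1 \<union> J (-1)"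
  proof clarify
    fix q p assume q: "q \<in> Q" and p: "p \<in> P" and n: "(q, p) \<notin> J (-1)" and d: "\<delta> = dist q p"
    have e: "(p $ 1 - q $ 1)\<^sup>2 + (p $ 2 - q $ 2)\<^sup>2 = \<delta>\<^sup>2"
      using d \<delta> dist_vec2_eq_iff[of \<delta> p q] by (simp add: dist_commute)
    then have "(p $ 1 - q $ 1)\<^sup>2 \<le> \<delta>\<^sup>2" by (smt (verit) zero_le_power2)
    then have "\<bar>p $ 1 - q $ 1\<bar> \<le> \<delta>" using \<delta> by (simp add: abs_le_square_iff[symmetric])
    then have dom: "q $ 1 - \<delta> \<le> p $ 1" "p $ 1 \<le> q $ 1 + \<delta>" by linarith+
    have "sqrt (\<delta>\<^sup>2 - (p $ 1 - q $ 1)\<^sup>2) = \<bar>p $ 2 - q $ 2\<bar>" using e by (simp flip: e)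
    then have "semicircle 1 \<delta> q (p $ 1) = p $ 2 \<or> semicircle (-1) \<delta> q (p $ 1) = p $ 2"
      by (auto simp: semicircle_def abs_if)
    then show "(q, p) \<in> J 1" using n q p dom J(3)[of 1] J(3)[of "-1"] by auto
  qed
  then have "I \<le> card (J 1 \<union> J (-1))"
    unfolding I_def using J(1)[of 1] J(1)[of "-1"] by (intro card_mono) auto
  also have "\<dots> \<le> card (J 1) + card (J (-1))" by (rule card_Un_le)
  finally obtain \<sigma> :: real where \<sigma>: "\<sigma> = 1 \<or> \<sigma> = -1" "I \<le> 2 * card (J \<sigma>)"
    by (metis (no_types, opaque_lifting) add_le_mono le_trans linear mult_2)
  then have "I ^ 3 \<le> (2 * card (J \<sigma>)) ^ 3" by (intro power_mono) auto
  then show ?thesis using J(2)[OF \<sigma>(1)] \<sigma>(2) by (auto simp: power_mult_distrib)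
qed

section \<open>Intersections of two circles\<close>

lemma circles_meet_twice:
  fixes a b :: "real^2"
  assumes ab: "a \<noteq> b" and r: "r > 0" "s > 0"
  shows "\<exists>u v. {z. dist a z = r \<and> dist z b = s} \<subseteq> {u, v}"
proof (cases "{z. dist a z = r \<and> dist z b = s} = {}")
  case False
  then obtain u where u: "dist a u = r" "dist u b = s" by auto
  define c1 c2 k1 k2 where "c1 = b $ 1 - a $ 1" and "c2 = b $ 2 - a $ 2"
    and "k1 = u $ 1 - a $ 1" and "k2 = u $ 2 - a $ 2"
  define N where "N = c1\<^sup>2 + c2\<^sup>2"
  have "c1 \<noteq> 0 \<or> c2 \<noteq> 0" using ab vec2_eqI[of a b] by (auto simp: c1_def c2_def)
  then have N: "N \<noteq> 0" by (simp add: N_def sum_power2_eq_zero_iff)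
  \<comment> \<open>This is the mirror image of \<open>u\<close> in the line through the centres
    \<open>a\<close> and \<open>b\<close>.\<close>
  define v :: "real^2" where "v = (\<chi> i. u $ i - 2 * (c1 * k2 - c2 * k1) / N * (if i = 1 then - c2 else c1))"
  have "z = u \<or> z = v" if z: "dist a z = r" "dist z b = s" for z
  proof -
    define w1 w2 where "w1 = z $ 1 - u $ 1" and "w2 = z $ 2 - u $ 2"
    note defs = c1_def c2_def k1_def k2_def w1_def w2_def
    have e: "(a $ 1 - u $ 1)\<^sup>2 + (a $ 2 - u $ 2)\<^sup>2 = r\<^sup>2" "(u $ 1 - b $ 1)\<^sup>2 + (u $ 2 - b $ 2)\<^sup>2 = s\<^sup>2"
      "(a $ 1 - z $ 1)\<^sup>2 + (a $ 2 - z $ 2)\<^sup>2 = r\<^sup>2" "(z $ 1 - b $ 1)\<^sup>2 + (z $ 2 - b $ 2)\<^sup>2 = s\<^sup>2"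
      using u z r dist_vec2_eq_iff by (metis less_imp_le)+
    \<comment> \<open>Subtracting the circle equations shows \<open>z - u\<close> perpendicular to
      \<open>b - a\<close>, so it is a multiple \<open>t\<close> of \<open>(- c2, c1)\<close>. The
      circle around \<open>a\<close> then gives a quadratic equation in \<open>t\<close> with root
      0; the other root yields \<open>v\<close>.\<close>
    have p: "w1 * c1 + w2 * c2 = 0" using e unfolding defs by (simp add: power2_eq_square algebra_simps)
    have k: "w1\<^sup>2 + w2\<^sup>2 + 2 * (w1 * k1 + w2 * k2) = 0" using e unfolding defs by (simp add: power2_eq_square algebra_simps)
    define t where "t = (w2 * c1 - w1 * c2) / N"
    have t: "w2 * c1 - w1 * c2 = t * N" using N by (simp add: t_def)
    have "w1 * N = (w1 * c1 + w2 * c2) * c1 - (w2 * c1 - w1 * c2) * c2"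
      by (simp add: N_def power2_eq_square algebra_simps)
    also have "\<dots> = - t * c2 * N" unfolding p t by simp
    finally have w1: "w1 = - t * c2" using N mult_right_cancel by blast
    have "w2 * N = (w1 * c1 + w2 * c2) * c2 + (w2 * c1 - w1 * c2) * c1"
      by (simp add: N_def power2_eq_square algebra_simps)
    also have "\<dots> = t * c1 * N" unfolding p t by simp
    finally have w2: "w2 = t * c1" using N mult_right_cancel by blast
    note w = w1 w2
    have "t * (t * N + 2 * (c1 * k2 - c2 * k1)) = 0"
      using k unfolding w N_def by (simp add: power2_eq_square algebra_simps)
    then have "t = 0 \<or> t * N = - (2 * (c1 * k2 - c2 * k1))" by (simp only: mult_eq_0_iff eq_neg_iff_add_eq_0)
    then show ?thesis
    proof
      assume "t = 0"
      then have "z = u" using w by (intro vec2_eqI) (auto simp: w1_def w2_def)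
      then show ?thesis ..
    next
      assume "t * N = - (2 * (c1 * k2 - c2 * k1))"
      then have "t = - (2 * (c1 * k2 - c2 * k1) / N)" using N by (simp add: field_simps)
      then have "z = v" using w by (intro vec2_eqI) (auto simp: w1_def w2_def v_def)
      then show ?thesis ..
    qed
  qed
  then show ?thesis by blast
qed auto

lemma card_circles_meet_le_2:
  fixes a b :: "real^2"
  assumes "a \<noteq> b" "r > 0" "s > 0"
  shows "finite {z. dist a z = r \<and> dist z b = s}" "card {z. dist a z = r \<and> dist z b = s} \<le> 2"
proof -
  obtain u v where uv: "{z. dist a z = r \<and> dist z b = s} \<subseteq> {u, v}"
    using circles_meet_twice[OF assms] by blast
  show "finite {z. dist a z = r \<and> dist z b = s}" using finite_subset[OF uv] by simp
  show "card {z. dist a z = r \<and> dist z b = s} \<le> 2"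
    using card_mono[OF _ uv] card_insert_le_m1[of 2 "{v}" u] by (simp add: card_insert_if split: if_splits)
qed

section \<open>Chains\<close>

definition heavy :: "(real^2) set \<Rightarrow> real \<Rightarrow> real \<Rightarrow> (real^2) set" where
  "heavy P \<delta> t = {p\<in>P. t < real (card {q\<in>P. dist q p = \<delta>})}"

text \<open>Each heavy point has more than \<open>t\<close> incidences, so
  \<open>t * card H \<le> I\<close>. Putting this into the cubic incidence bound and cancelling
  \<open>I ^ 2\<close> leaves the first term. In the linear case \<open>card H \<le> n\<close> gives
  the coefficient \<open>28 = 4 + 24\<close>.\<close>

lemma heavy_incidences:
  assumes P: "finite P" and \<delta>: "\<delta> > 0" and t: "t > 0"
  shows "real (card {(q, p). q \<in> P \<and> p \<in> heavy P \<delta> t \<and> dist q p = \<delta>})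
    \<le> 18432 * ((real (card P))\<^sup>2 / t\<^sup>2) + 28 * real (card P)"
proof -
  define H where "H = heavy P \<delta> t"
  define n where "n = card P"
  define I where "I = card {(q, p). q \<in> P \<and> p \<in> H \<and> dist q p = \<delta>}"
  have H: "finite H" "H \<subseteq> P" using P by (auto simp: H_def heavy_def)
  have m: "card H \<le> n" using card_mono[OF P H(2)] by (simp add: n_def)
  have "{(q, p). q \<in> P \<and> p \<in> H \<and> dist q p = \<delta>} = prod.swap ` (SIGMA p:H. {q\<in>P. dist q p = \<delta>})"
    by (auto simp: image_iff)
  then have "I = (\<Sum>p\<in>H. card {q\<in>P. dist q p = \<delta>})"
    using H P by (simp add: I_def card_image)
  then have "real I = (\<Sum>p\<in>H. real (card {q\<in>P. dist q p = \<delta>}))" by simp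
  also have "\<dots> \<ge> (\<Sum>p\<in>H. t)" by (intro sum_mono) (auto simp: H_def heavy_def)
  finally have Ht: "t * real (card H) \<le> real I" by (simp add: mult.commute)
  have "I \<le> 4 * n + 24 * card H \<or> I ^ 3 \<le> 18432 * card H ^ 2 * n ^ 2"
    unfolding I_def n_def using H P \<delta> by (intro distance_incidence_bound) auto
  then have "real I \<le> 18432 * ((real n)\<^sup>2 / t\<^sup>2) + 28 * real n"
  proof
    assume "I \<le> 4 * n + 24 * card H"
    then have "real I \<le> 28 * real n" using m by linarith
    then show ?thesis by (simp add: add_increasing)
  next
    assume "I ^ 3 \<le> 18432 * card H ^ 2 * n ^ 2"
    then have "real (I ^ 3) \<le> real (18432 * card H ^ 2 * n ^ 2)" by (rule of_nat_mono)
    then have "t\<^sup>2 * (real I) ^ 3 \<le> t\<^sup>2 * (18432 * (real (card H))\<^sup>2 * (real n)\<^sup>2)"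
      by (intro mult_left_mono) auto
    also have "\<dots> = 18432 * (t * real (card H))\<^sup>2 * (real n)\<^sup>2" by (simp add: power_mult_distrib)
    also have "\<dots> \<le> 18432 * (real I)\<^sup>2 * (real n)\<^sup>2"
      using Ht t by (intro mult_right_mono mult_left_mono power_mono) auto
    finally have *: "(real I)\<^sup>2 * (t\<^sup>2 * real I) \<le> (real I)\<^sup>2 * (18432 * (real n)\<^sup>2)"
      by (simp add: power_numeral_reduce algebra_simps)
    have "real I \<le> 18432 * ((real n)\<^sup>2 / t\<^sup>2)"
    proof (cases "I = 0")
      case False
      then have "t\<^sup>2 * real I \<le> 18432 * (real n)\<^sup>2" using * by (simp add: mult_le_cancel_left)
      then show ?thesis using t by (simp add: field_simps)
    qed simp
    then show ?thesis by simp
  qed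
  then show ?thesis unfolding I_def n_def H_def .
qed

section \<open>Cutting and reversing chains\<close>

lemma k_chains_Cons:
  "p # qs \<in> k_chains (Suc k) P (d # ds) \<longleftrightarrow>
     qs \<in> k_chains k P ds \<and> p \<in> P \<and> p \<notin> set qs \<and> dist p (hd qs) = d"
proof (cases qs)
  case Nil then show ?thesis by (simp add: k_chains_def)
next
  case (Cons q qs')
  then show ?thesis by (auto simp: k_chains_def All_less_Suc2)
qed

lemma k_chains_rev:
  assumes "ps \<in> k_chains k P ds" "length ds = k"
  shows "rev ps \<in> k_chains k P (rev ds)"
proof -
  have len: "length ps = k + 1" using assms by (simp add: k_chains_def)
  have "dist (rev ps ! j) (rev ps ! (j + 1)) = rev ds ! j" if j: "j < k" for j
  proof -
    \<comment> \<open>Distance \<open>j\<close> of the reversed list is distance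
      \<open>k - Suc j\<close> of the original one, between its points \<open>i\<close> and
      \<open>i + 1\<close>.\<close>
    define i where "i = k - Suc j"
    have i: "i < k" "k - j = i + 1" "k - (j + 1) = i" using j by (auto simp: i_def)
    have "rev ps ! j = ps ! (i + 1)" "rev ps ! (j + 1) = ps ! i" "rev ds ! j = ds ! i"
      using j len assms(2) i by (simp_all add: rev_nth i_def)
    moreover have "dist (ps ! i) (ps ! (i + 1)) = ds ! i" using assms(1) i by (simp add: k_chains_def)
    ultimately show ?thesis by (simp add: dist_commute)
  qed
  then show ?thesis using assms by (simp add: k_chains_def)
qed

lemma k_chains_snocD:
  assumes "qs @ [q] \<in> k_chains (Suc k) P (ds @ [d])" "length ds = k" "qs \<noteq> []"
  shows "qs \<in> k_chains k P ds" "q \<in> P" "dist q (last qs) = d"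
proof -
  have "q # rev qs \<in> k_chains (Suc k) P (d # rev ds)"
    using k_chains_rev[OF assms(1)] assms(2) by simp
  then have *: "rev qs \<in> k_chains k P (rev ds)" "q \<in> P" "dist q (hd (rev qs)) = d"
    by (auto simp: k_chains_Cons)
  show "q \<in> P" by fact
  show "dist q (last qs) = d" using *(3) by (simp add: hd_rev)
  show "qs \<in> k_chains k P ds" using k_chains_rev[OF *(1)] assms(2) by simp
qed

text \<open>Here \<open>rev ps ! 1\<close> and \<open>rev ds ! 0\<close> are the penultimate point
  and the last distance. Both deleted ends are neighbours of light points, so a middle chain extends
  in at most \<open>t * t\<close> ways.\<close>

lemma card_light_chains_le:
  assumes P: "finite P" and ds: "length ds = Suc (Suc k)"
    and t: "t \<ge> 0"
  shows "real (card {ps \<in> k_chains (Suc (Suc k)) P ds. ps ! 1 \<notin> heavy P (ds ! 0) t \<and> rev ps ! 1 \<notin> heavy P (rev ds ! 0) t})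
    \<le> t\<^sup>2 * real (card (k_chains k P (butlast (tl ds))))" (is "real (card ?A) \<le> _")
proof -
  obtain d ds' where ds1: "ds = d # ds'" using ds by (cases ds) auto
  obtain es d' where es: "ds' = es @ [d']" using ds ds1 by (cases ds' rule: rev_cases) auto
  have dseq: "ds = d # es @ [d']" using ds1 es by simp
  have len: "length es = k" using ds dseq by simp
  define N where "N = (\<lambda>\<delta> p. {q\<in>P. dist q p = \<delta>})"
  have finN: "finite (N \<delta> p)" for \<delta> p using P by (auto simp: N_def)
  define M where "M = {m \<in> k_chains k P es. hd m \<notin> heavy P d t \<and> last m \<notin> heavy P d' t}"
  have finM: "finite M" using finite_k_chains[OF P] by (auto simp: M_def)
  have sub: "?A \<subseteq> (\<lambda>(m, p, q). p # m @ [q]) ` (SIGMA m:M. N d (hd m) \<times> N d' (last m))"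
  proof
    fix ps assume ps: "ps \<in> ?A"
    then have l: "length ps = Suc (Suc (Suc k))" by (auto simp: k_chains_def)
    obtain p r where r: "ps = p # r" using l by (cases ps) auto
    obtain m q where m: "r = m @ [q]" using l r by (cases r rule: rev_cases) auto
    have pseq: "ps = p # m @ [q]" using r m by simp
    have ml: "length m = Suc k" using l pseq by simp
    then have mne: "m \<noteq> []" by auto
    have "p # (m @ [q]) \<in> k_chains (Suc (Suc k)) P (d # (es @ [d']))" using ps pseq dseq by simp
    then have mq: "m @ [q] \<in> k_chains (Suc k) P (es @ [d'])" "p \<in> P" "dist p (hd m) = d"
      using mne by (auto simp: k_chains_Cons)
    note * = k_chains_snocD[OF mq(1) len mne]
    have "ps ! 1 = hd m" "rev ps ! 1 = last m"
      using pseq mne by (simp_all add: nth_append hd_conv_nth rev_nth last_conv_nth)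
    then have "m \<in> M" using ps * dseq by (simp add: M_def)
    then show "ps \<in> (\<lambda>(m, p, q). p # m @ [q]) ` (SIGMA m:M. N d (hd m) \<times> N d' (last m))"
      using * mq pseq by (intro image_eqI[of _ _ "(m, p, q)"]) (auto simp: N_def)
  qed
  have finS: "finite (SIGMA m:M. N d (hd m) \<times> N d' (last m))" using finM finN by auto
  have "card ?A \<le> card (SIGMA m:M. N d (hd m) \<times> N d' (last m))"
    by (rule surj_card_le[OF finS sub])
  also have "\<dots> = (\<Sum>m\<in>M. card (N d (hd m)) * card (N d' (last m)))"
    using finM finN by (simp add: card_cartesian_product)
  finally have "real (card ?A) \<le> (\<Sum>m\<in>M. real (card (N d (hd m))) * real (card (N d' (last m))))"
    by (simp flip: of_nat_mult of_nat_sum)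
  also have "\<dots> \<le> (\<Sum>m\<in>M. t * t)"
  proof (intro sum_mono mult_mono)
    fix m assume m: "m \<in> M"
    then have "m \<noteq> []" "set m \<subseteq> P" by (auto simp: M_def k_chains_def)
    then have "hd m \<in> P" "last m \<in> P" by auto
    then show "real (card (N d (hd m))) \<le> t" "real (card (N d' (last m))) \<le> t"
      using m by (auto simp: M_def heavy_def N_def)
  qed (use t in auto)
  also have "\<dots> = t\<^sup>2 * real (card M)" by (simp add: power2_eq_square)
  also have "\<dots> \<le> t\<^sup>2 * real (card (k_chains k P es))"
    using card_mono[OF finite_k_chains[OF P], of M k es] by (intro mult_left_mono) (auto simp: M_def)
  finally show ?thesis using dseq by simp
qed

text \<open>Cut the chain as \<open>q # p # z # r\<close>: the pair \<open>(q, p)\<close> is an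
  incidence, \<open>r\<close> is a chain for the distances after the first three, and
  \<open>z\<close> lies on a circle around \<open>p\<close> and on one around
  \<open>hd r\<close>.\<close>

lemma card_heavy_chains_le:
  assumes P: "finite P" and H: "finite H" and ds: "length ds = k + 3" "\<forall>\<delta>\<in>set ds. \<delta> > 0"
  shows "card {ps \<in> k_chains (k + 3) P ds. ps ! 1 \<in> H}
    \<le> 2 * (card {(q, p). q \<in> P \<and> p \<in> H \<and> dist q p = ds ! 0} * card (k_chains k P (drop 3 ds)))"
    (is "card ?A \<le> 2 * (card ?I * card ?C)")
proof -
  obtain d1 d2 d3 es where dseq: "ds = d1 # d2 # d3 # es"
    using ds(1) by (auto simp: length_Suc_conv numeral_3_eq_3)
  define B where "B = {((q, p), r). (q, p) \<in> ?I \<and> r \<in> ?C \<and> p \<noteq> hd r}"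
  define Z where "Z = (\<lambda>((q :: real^2, p :: real^2), r). {z. dist p z = d2 \<and> dist z (hd r) = d3})"
  have finI: "finite ?I" by (rule finite_subset[of _ "P \<times> H"]) (use P H in auto)
  have finC: "finite ?C" using finite_k_chains[OF P] .
  have BIC: "B \<subseteq> ?I \<times> ?C" by (auto simp: B_def)
  have finB: "finite B" using finite_subset[OF BIC] finI finC by blast
  have Z: "finite (Z b)" "card (Z b) \<le> 2" if "b \<in> B" for b
    using that ds dseq card_circles_meet_le_2 by (auto simp: B_def Z_def)
  have sub: "?A \<subseteq> (\<lambda>(((q, p), r), z). q # p # z # r) ` (SIGMA b:B. Z b)"
  proof
    fix ps assume ps: "ps \<in> ?A"
    then have "length ps = k + 4" by (auto simp: k_chains_def)
    then obtain q p z r where pseq: "ps = q # p # z # r"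
      by (auto simp: length_Suc_conv numeral_eq_Suc)
    have "q # p # z # r \<in> k_chains (Suc (Suc (Suc k))) P (d1 # d2 # d3 # es)"
      using ps pseq dseq by (simp add: numeral_3_eq_3)
    then have *: "r \<in> k_chains k P es" "q \<in> P" "p \<notin> set r" "dist q p = d1" "dist p z = d2" "dist z (hd r) = d3"
      by (auto simp: k_chains_Cons)
    then have "r \<noteq> []" by (auto simp: k_chains_def)
    \<comment> \<open>Distinctness of the chain separates the two centres, so the circles share at
      most two points.\<close>
    then have "p \<noteq> hd r" using *(3) by auto
    then have "((q, p), r) \<in> B" using * ps pseq dseq by (simp add: B_def numeral_3_eq_3)
    then show "ps \<in> (\<lambda>(((q, p), r), z). q # p # z # r) ` (SIGMA b:B. Z b)"
      using * pseq by (intro image_eqI[of _ _ "(((q, p), r), z)"]) (auto simp: Z_def)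
  qed
  have finS: "finite (SIGMA b:B. Z b)" using finB Z by auto
  have "card ?A \<le> card (SIGMA b:B. Z b)"
    by (rule surj_card_le[OF finS sub])
  also have "\<dots> = (\<Sum>b\<in>B. card (Z b))" using finB Z by simp
  also have "\<dots> \<le> (\<Sum>b\<in>B. 2)" using Z by (intro sum_mono) auto
  also have "\<dots> = 2 * card B" by simp
  also have "card B \<le> card (?I \<times> ?C)" using BIC finI finC by (intro card_mono) auto
  finally show ?thesis by (simp add: card_cartesian_product)
qed

section \<open>The recursive step for the exponents\<close>

definition chain_bound :: "nat \<Rightarrow> real \<Rightarrow> bool" where
  "chain_bound k e \<longleftrightarrow> (\<exists>c\<ge>0. \<forall>P ds. finite P \<and> P \<noteq> {} \<and> length ds = k \<and> (\<forall>\<delta>\<in>set ds. \<delta> > 0) \<longrightarrow>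
     real (card (k_chains k P ds)) \<le> c * real (card P) powr e)"

lemma chain_bound_step:
  assumes "chain_bound k a" "chain_bound (Suc k) b" and ab: "a \<le> b"
  shows "chain_bound (k + 3) ((a + b) / 2 + 1)"
proof -
  obtain ca where ca: "ca \<ge> 0" "\<And>P ds. finite P \<Longrightarrow> P \<noteq> {} \<Longrightarrow> length ds = k \<Longrightarrow> \<forall>\<delta>\<in>set ds. \<delta> > 0 \<Longrightarrow>
     real (card (k_chains k P ds)) \<le> ca * real (card P) powr a" using assms(1) unfolding chain_bound_def by blast
  obtain cb where cb: "cb \<ge> 0" "\<And>P ds. finite P \<Longrightarrow> P \<noteq> {} \<Longrightarrow> length ds = Suc k \<Longrightarrow> \<forall>\<delta>\<in>set ds. \<delta> > 0 \<Longrightarrow>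
     real (card (k_chains (Suc k) P ds)) \<le> cb * real (card P) powr b" using assms(2) unfolding chain_bound_def by blast
  \<comment> \<open>The number \<open>36920 = 2 * (18432 + 28)\<close> includes the two choices of
    the third point. The further factor 2 covers a heavy second and a heavy penultimate
    point.\<close>
  have "real (card (k_chains (k + 3) P ds)) \<le> (cb + 2 * (36920 * ca)) * real (card P) powr ((a + b) / 2 + 1)"
    if P: "finite P" "P \<noteq> {}" and ds: "length ds = k + 3" "\<forall>\<delta>\<in>set ds. \<delta> > 0" for P ds
  proof -
    define n where "n = real (card P)"
    define X where "X = n powr ((a + b) / 2 + 1)"
    have n: "n \<ge> 1" using P by (simp add: n_def Suc_le_eq card_gt_0_iff)
    \<comment> \<open>This threshold balances \<open>t\<^sup>2 n\<^sup>b\<close> against \<open>n\<^sup>2 / t\<^sup>2 n\<^sup>a\<close>.\<close>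
    define t where "t = n powr (1 / 2 + (a - b) / 4)"
    have t: "t > 0" using n by (simp add: t_def)
    have t2: "t\<^sup>2 = n powr (1 + (a - b) / 2)"
    proof -
      have "(1 / 2 + (a - b) / 4) + (1 / 2 + (a - b) / 4) = 1 + (a - b) / 2" by linarith
      then show ?thesis unfolding t_def power2_eq_square powr_add[symmetric] by simp
    qed
    have nt: "n\<^sup>2 / t\<^sup>2 = n powr (1 - (a - b) / 2)"
    proof -
      have "n\<^sup>2 = n powr 2" using n by (simp add: powr_numeral)
      then show ?thesis unfolding t2 by (simp add: powr_diff[symmetric])
    qed
    define A where "A = {ps \<in> k_chains (k + 3) P ds. ps ! 1 \<notin> heavy P (ds ! 0) t \<and> rev ps ! 1 \<notin> heavy P (rev ds ! 0) t}"
    define B where "B = (\<lambda>ds. {ps \<in> k_chains (k + 3) P ds. ps ! 1 \<in> heavy P (ds ! 0) t})"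
    have fin: "finite (k_chains j P es)" for j es using finite_k_chains[OF P(1)] .
    have finB: "finite (B es)" for es using fin by (auto simp: B_def)
    have heavyfin: "finite (heavy P \<delta> t)" for \<delta> using P by (auto simp: heavy_def)
    have Abound: "real (card A) \<le> cb * X"
    proof -
      have "real (card A) \<le> t\<^sup>2 * real (card (k_chains (Suc k) P (butlast (tl ds))))"
        unfolding A_def using card_light_chains_le[OF P(1), of ds "Suc k" t] ds t by (simp add: numeral_3_eq_3)
      also have "\<dots> \<le> t\<^sup>2 * (cb * n powr b)"
      proof (intro mult_left_mono)
        have "set (butlast (tl ds)) \<subseteq> set ds"
          by (cases ds) (auto dest: in_set_butlastD)
        then show "real (card (k_chains (Suc k) P (butlast (tl ds)))) \<le> cb * n powr b"
          unfolding n_def using ds by (intro cb P) auto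
      qed simp
      also have "\<dots> = cb * n powr (1 + (a - b) / 2 + b)" unfolding t2 by (simp add: powr_add)
      also have "1 + (a - b) / 2 + b = (a + b) / 2 + 1" by (simp add: field_simps)
      finally show ?thesis by (simp add: X_def)
    qed
    have Bbound: "real (card (B es)) \<le> 36920 * ca * X" if es: "length es = k + 3" "\<forall>\<delta>\<in>set es. \<delta> > 0" for es
    proof -
      have e0: "es ! 0 > 0" using es by auto
      \<comment> \<open>Since \<open>a \<le> b\<close>, this exponent is at least 1, so
        \<open>n^2 / t^2\<close> absorbs the linear term of the incidence bound.\<close>
      have n_le: "n \<le> n powr (1 - (a - b) / 2)"
        using n ab powr_mono[of 1 "1 - (a - b) / 2" n] by simp
      define I where "I = real (card {(q, p). q \<in> P \<and> p \<in> heavy P (es ! 0) t \<and> dist q p = es ! 0})"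
      have "card (B es) \<le> 2 * (card {(q, p). q \<in> P \<and> p \<in> heavy P (es ! 0) t \<and> dist q p = es ! 0} * card (k_chains k P (drop 3 es)))"
        unfolding B_def by (rule card_heavy_chains_le[OF P(1) heavyfin es])
      then have "real (card (B es)) \<le> 2 * (I * real (card (k_chains k P (drop 3 es))))"
        unfolding I_def by (simp flip: of_nat_mult)
      also have "\<dots> \<le> 2 * ((18432 * (n\<^sup>2 / t\<^sup>2) + 28 * n) * (ca * n powr a))"
      proof (intro mult_left_mono mult_mono)
        show "I \<le> 18432 * (n\<^sup>2 / t\<^sup>2) + 28 * n" unfolding I_def n_def
          by (rule heavy_incidences[OF P(1) e0 t])
        have "set (drop 3 es) \<subseteq> set es" by (rule set_drop_subset)
        then show "real (card (k_chains k P (drop 3 es))) \<le> ca * n powr a"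
          unfolding n_def using es by (intro ca P) auto
      qed (use n in auto)
      also have "\<dots> \<le> 2 * ((18432 * n powr (1 - (a - b) / 2) + 28 * n powr (1 - (a - b) / 2)) * (ca * n powr a))"
        unfolding nt using ca(1) n_le by (intro mult_left_mono mult_right_mono) auto
      also have "\<dots> = 36920 * ca * n powr (1 - (a - b) / 2 + a)" unfolding powr_add by simp
      also have "1 - (a - b) / 2 + a = (a + b) / 2 + 1" by (simp add: field_simps)
      finally show ?thesis by (simp add: X_def)
    qed
    \<comment> \<open>Reversal turns a chain with heavy penultimate point into one with heavy second
      point for the reversed distances.\<close>
    have "k_chains (k + 3) P ds \<subseteq> A \<union> (B ds \<union> rev ` B (rev ds))"
    proof
      fix ps assume ps: "ps \<in> k_chains (k + 3) P ds"
      have "ps \<in> rev ` B (rev ds)" if "rev ps ! 1 \<in> heavy P (rev ds ! 0) t"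
        using k_chains_rev[OF ps ds(1)] that by (intro image_eqI[of _ _ "rev ps"]) (auto simp: B_def)
      then show "ps \<in> A \<union> (B ds \<union> rev ` B (rev ds))"
        using ps unfolding A_def B_def by blast
    qed
    then have "card (k_chains (k + 3) P ds) \<le> card (A \<union> (B ds \<union> rev ` B (rev ds)))"
      using finB fin by (intro card_mono) (auto simp: A_def)
    also have "\<dots> \<le> card A + (card (B ds) + card (rev ` B (rev ds)))"
      by (meson card_Un_le add_left_mono order_trans)
    also have "card (rev ` B (rev ds)) \<le> card (B (rev ds))" using finB by (rule card_image_le)
    finally have "real (card (k_chains (k + 3) P ds)) \<le> real (card A) + (real (card (B ds)) + real (card (B (rev ds))))"
      by linarith
    also have "\<dots> \<le> cb * X + (36920 * ca * X + 36920 * ca * X)"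
      using Abound Bbound[of ds] Bbound[of "rev ds"] ds by (intro add_mono) auto
    finally show ?thesis by (simp add: X_def n_def algebra_simps)
  qed
  then show ?thesis unfolding chain_bound_def using ca(1) cb(1)
    by (intro exI[of _ "cb + 2 * (36920 * ca)"]) auto
qed

section \<open>Chains with at most two distances\<close>

lemma chain_bound_0: "chain_bound 0 1"
proof -
  have "real (card (k_chains 0 P ds)) \<le> 1 * real (card P) powr 1" if P: "finite P" "P \<noteq> {}" for P ds
  proof -
    have "k_chains 0 P ds \<subseteq> (\<lambda>p. [p]) ` P" by (auto simp: k_chains_def length_Suc_conv)
    then have "card (k_chains 0 P ds) \<le> card ((\<lambda>p. [p]) ` P)" using P by (intro card_mono) auto
    also have "\<dots> \<le> card P" using P by (intro card_image_le) auto
    finally show ?thesis by simp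
  qed
  then show ?thesis unfolding chain_bound_def by (intro exI[of _ 1]) auto
qed

text \<open>Pairs at a fixed distance are the incidences of the point set with the circles around
  its own points.\<close>

lemma chain_bound_1: "chain_bound 1 (4/3)"
proof -
  have "real (card (k_chains 1 P ds)) \<le> 28 * real (card P) powr (4/3)"
    if P: "finite P" "P \<noteq> {}" and ds: "length ds = 1" "\<forall>\<delta>\<in>set ds. \<delta> > 0" for P ds
  proof -
    obtain d where d: "ds = [d]" "d > 0" using ds by (auto simp: length_Suc_conv)
    define n where "n = card P"
    have n: "real n \<ge> 1" using P by (simp add: n_def Suc_le_eq card_gt_0_iff)
    define S where "S = {(q, p). q \<in> P \<and> p \<in> P \<and> dist q p = d}"
    have finS: "finite S" by (rule finite_subset[of _ "P \<times> P"]) (use P in \<open>auto simp: S_def\<close>)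
    have "k_chains 1 P ds \<subseteq> (\<lambda>(q, p). [q, p]) ` S"
    proof
      fix ps assume ps: "ps \<in> k_chains 1 P ds"
      then obtain q p where "ps = [q, p]" by (auto simp: k_chains_def length_Suc_conv)
      then show "ps \<in> (\<lambda>(q, p). [q, p]) ` S"
        using ps d by (intro image_eqI[of _ _ "(q, p)"]) (auto simp: k_chains_def S_def)
    qed
    then have "card (k_chains 1 P ds) \<le> card S"
      by (rule surj_card_le[OF finS])
    moreover have "real (card S) \<le> 28 * real n powr (4/3)"
      using distance_incidence_bound[OF P(1) P(1) d(2)] unfolding S_def[symmetric] n_def[symmetric]
    proof
      assume "card S \<le> 4 * n + 24 * n"
      then have "real (card S) \<le> 28 * real n powr 1" using n by simp
      also have "\<dots> \<le> 28 * real n powr (4/3)" using n by (intro mult_left_mono powr_mono) auto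
      finally show ?thesis .
    next
      assume "card S ^ 3 \<le> 18432 * n ^ 2 * n ^ 2"
      then have "real (card S ^ 3) \<le> real (18432 * n ^ 2 * n ^ 2)" by (rule of_nat_mono)
      then have "real (card S) ^ 3 \<le> 18432 * real n ^ 4" by (simp add: power_numeral_reduce mult.assoc)
      \<comment> \<open>The constant 28 comes from the linear case and also covers the cubic one, as
        \<open>28 ^ 3 = 21952\<close>.\<close>
      also have "\<dots> \<le> 21952 * real n ^ 4" by simp
      also have "\<dots> = (28 * real n powr (4/3)) ^ 3"
        using n by (simp add: power_mult_distrib powr_power powr_numeral)
      finally show ?thesis by (rule power_le_imp_le_base[of _ 2, simplified]) simp
    qed
    ultimately show ?thesis by (simp add: n_def)
  qed
  then show ?thesis unfolding chain_bound_def by (intro exI[of _ 28]) auto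
qed

text \<open>The two ends are distinct and determine the middle point up to two choices.\<close>

lemma chain_bound_2: "chain_bound 2 2"
proof -
  have "real (card (k_chains 2 P ds)) \<le> 2 * real (card P) powr 2"
    if P: "finite P" "P \<noteq> {}" and ds: "length ds = 2" "\<forall>\<delta>\<in>set ds. \<delta> > 0" for P ds
  proof -
    obtain d d' where d: "ds = [d, d']" "d > 0" "d' > 0" using ds by (auto simp: length_Suc_conv numeral_2_eq_2)
    define B where "B = {(p, r). p \<in> P \<and> r \<in> P \<and> p \<noteq> r}"
    define Z where "Z = (\<lambda>(p :: real^2, r). {z. dist p z = d \<and> dist z r = d'})"
    have finB: "finite B" and BP: "B \<subseteq> P \<times> P" using P by (auto simp: B_def intro: finite_subset[of _ "P \<times> P"])
    have Z: "finite (Z b)" "card (Z b) \<le> 2" if "b \<in> B" for b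
      using that d card_circles_meet_le_2 by (auto simp: B_def Z_def)
    have sub: "k_chains 2 P ds \<subseteq> (\<lambda>((p, r), z). [p, z, r]) ` (SIGMA b:B. Z b)"
    proof
      fix ps assume ps: "ps \<in> k_chains 2 P ds"
      then obtain p z r where "ps = [p, z, r]" by (auto simp: k_chains_def length_Suc_conv numeral_2_eq_2)
      then show "ps \<in> (\<lambda>((p, r), z). [p, z, r]) ` (SIGMA b:B. Z b)"
        using ps d by (intro image_eqI[of _ _ "((p, r), z)"])
          (auto simp: k_chains_def B_def Z_def numeral_2_eq_2 All_less_Suc2)
    qed
    have finS: "finite (SIGMA b:B. Z b)" using finB Z by auto
    have "card (k_chains 2 P ds) \<le> card (SIGMA b:B. Z b)"
      by (rule surj_card_le[OF finS sub])
    also have "\<dots> = (\<Sum>b\<in>B. card (Z b))" using finB Z by simp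
    also have "\<dots> \<le> (\<Sum>b\<in>B. 2)" using Z by (intro sum_mono) auto
    also have "\<dots> = 2 * card B" by simp
    also have "card B \<le> card (P \<times> P)" using BP P by (intro card_mono) auto
    finally have "card (k_chains 2 P ds) \<le> 2 * card P ^ 2"
      by (simp add: card_cartesian_product power2_eq_square)
    then have "real (card (k_chains 2 P ds)) \<le> real (2 * card P ^ 2)" by (rule of_nat_mono)
    then show ?thesis using P by (simp add: powr_numeral card_gt_0_iff)
  qed
  then show ?thesis unfolding chain_bound_def by (intro exI[of _ 2]) auto
qed

section \<open>Closed form of the exponent\<close>

definition chain_exponent :: "nat \<Rightarrow> real" where
  "chain_exponent k = 2 * real k / 5 + 1 + chain_gamma k"

lemma chain_exponent_base: "chain_exponent 0 = 1" "chain_exponent 1 = 4/3" "chain_exponent 2 = 2"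
  by (simp_all add: chain_exponent_def chain_gamma_def)

text \<open>The slope \<open>2/5\<close> accounts for the summand 1. The characteristic polynomial
  is \<open>x^3 - x/2 - 1/2 = (x - 1) * (x^2 + x + 1/2)\<close>; the complex root
  \<open>(-1 + i) / 2\<close> and its conjugate have fourth power \<open>-1/4\<close>, whence the
  cases modulo 4.\<close>

lemma chain_exponent_rec:
  "chain_exponent (k + 3) = (chain_exponent k + chain_exponent (Suc k)) / 2 + 1"
proof -
  define j where "j = k div 4"
  define y where "y = (-1/4 :: real) ^ j"
  \<comment> \<open>This is stated for arbitrary \<open>j\<close> and \<open>y\<close> in order to
    serve both \<open>k div 4\<close> and its successor, where \<open>y\<close> turns into
    \<open>- y / 4\<close>.\<close>
  have e: "chain_exponent (4 * j) = 8 * real j / 5 + 1 + (4 - 4 * y) / 75"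
    "chain_exponent (4 * j + 1) = 8 * real j / 5 + 7 / 5 + (4 - 9 * y) / 75"
    "chain_exponent (4 * j + 2) = 8 * real j / 5 + 9 / 5 + (4 + 11 * y) / 75"
    "chain_exponent (4 * j + 3) = 8 * real j / 5 + 11 / 5 + (4 - 13 / 2 * y) / 75"
    if "y = (-1/4 :: real) ^ j" for j y
  proof -
    have dm: "(4 * j) div 4 = j" "(4 * j + 1) div 4 = j" "(4 * j + 2) div 4 = j" "(4 * j + 3) div 4 = j"
      "(4 * j) mod 4 = 0" "(4 * j + 1) mod 4 = 1" "(4 * j + 2) mod 4 = 2" "(4 * j + 3) mod 4 = 3"
      by presburger+
    show "chain_exponent (4 * j) = 8 * real j / 5 + 1 + (4 - 4 * y) / 75"
      "chain_exponent (4 * j + 1) = 8 * real j / 5 + 7 / 5 + (4 - 9 * y) / 75"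
      "chain_exponent (4 * j + 2) = 8 * real j / 5 + 9 / 5 + (4 + 11 * y) / 75"
      "chain_exponent (4 * j + 3) = 8 * real j / 5 + 11 / 5 + (4 - 13 / 2 * y) / 75"
      unfolding chain_exponent_def chain_gamma_def dm that by (simp_all add: add_divide_distrib)
  qed
  note e0 = e[OF y_def]
  have "- y / 4 = (-1/4) ^ Suc j" by (simp add: y_def)
  note e1 = e[OF this]
  consider "k = 4 * j" | "k = 4 * j + 1" | "k = 4 * j + 2" | "k = 4 * j + 3"
    unfolding j_def by linarith
  then show ?thesis
  proof cases
    case 1
    then have *: "k + 3 = 4 * j + 3" "Suc k = 4 * j + 1" by auto
    show ?thesis unfolding * unfolding 1 e0 by (simp add: field_simps)
  next
    case 2
    then have *: "k + 3 = 4 * Suc j" "Suc k = 4 * j + 2" by auto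
    show ?thesis unfolding * unfolding 2 e0 e1 by (simp add: field_simps)
  next
    case 3
    then have *: "k + 3 = 4 * Suc j + 1" "Suc k = 4 * j + 3" by auto
    show ?thesis unfolding * unfolding 3 e0 e1 by (simp add: field_simps)
  next
    case 4
    then have *: "k + 3 = 4 * Suc j + 2" "Suc k = 4 * Suc j" by auto
    show ?thesis unfolding * unfolding 4 e0 e1 by (simp add: field_simps)
  qed
qed

text \<open>Writing \<open>E\<close> for \<open>chain_exponent\<close>, the recurrence gives
  \<open>E (k + 4) - E (k + 3) = (E (k + 2) - E k) / 2\<close>, which is non-negative by induction.
  This supplies the hypothesis \<open>a \<le> b\<close> of \<open>chain_bound_step\<close>.\<close>

lemma chain_exponent_mono: "chain_exponent k \<le> chain_exponent (Suc k)"
proof (induction k rule: less_induct)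
  case (less k)
  show ?case
  proof (cases "k < 3")
    case True
    then have "k = 0 \<or> k = 1 \<or> k = 2" by auto
    then show ?thesis using chain_exponent_base chain_exponent_rec[of 0] by (auto simp: numeral_2_eq_2 numeral_3_eq_3)
  next
    case False
    then obtain i where i: "k = i + 3" by (metis add.commute le_iff_add not_less)
    show ?thesis
      using less.IH[of i] less.IH[of "Suc i"] chain_exponent_rec[of i] chain_exponent_rec[of "Suc i"] i by simp
  qed
qed

lemma chain_bound_exponent: "chain_bound k (chain_exponent k)"
proof (induction k rule: less_induct)
  case (less k)
  show ?case
  proof (cases "k < 3")
    case True
    then have "k = 0 \<or> k = 1 \<or> k = 2" by auto
    then show ?thesis using chain_exponent_base chain_bound_0 chain_bound_1 chain_bound_2 by metis
  next
    case False
    then obtain i where i: "k = i + 3" by (metis add.commute le_iff_add not_less)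
    show ?thesis unfolding i chain_exponent_rec
      by (intro chain_bound_step less.IH chain_exponent_mono) (auto simp: i)
  qed
qed

theorem theorem1p1:
  fixes k :: nat
  assumes "k \<ge> 3"
  shows "(\<lambda>n. real (max_chains k n)) \<in>
           O(\<lambda>n. real n powr (2 * real k / 5 + 1 + chain_gamma k))"
proof -
  obtain c where c: "c \<ge> 0" "\<And>P ds. finite P \<Longrightarrow> P \<noteq> {} \<Longrightarrow> length ds = k \<Longrightarrow> \<forall>\<delta>\<in>set ds. \<delta> > 0 \<Longrightarrow>
     real (card (k_chains k P ds)) \<le> c * real (card P) powr chain_exponent k"
    using chain_bound_exponent[of k] unfolding chain_bound_def by blast
  have "real (max_chains k n) \<le> c * real n powr chain_exponent k" if n: "n \<ge> 1" for n
  proof -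
    \<comment> \<open>The maximum is attained by some configuration, which is non-empty for
      \<open>n \<ge> 1\<close>, so the uniform bound applies to it.\<close>
    have "max_chains k n \<in> chain_counts k n"
      unfolding max_chains_def by (intro Max_in finite_chain_counts chain_counts_nonempty)
    then obtain P ds where *: "max_chains k n = card (k_chains k P ds)" "finite P" "card P = n"
      "length ds = k" "\<forall>\<delta>\<in>set ds. \<delta> > 0" unfolding chain_counts_def by blast
    then have "P \<noteq> {}" using n by auto
    then show ?thesis using c(2)[of P ds] * by simp
  qed
  then show ?thesis
    unfolding chain_exponent_def
    by (intro bigoI[of _ c] eventually_mono[OF eventually_ge_at_top[of 1]]) auto
qed

end
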